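(* For $n\ge 1$ let \[ P_{n}^{(\mathrm{pk},\mathrm{ipk},\mathrm{des},\mathrm{ides})}(y,z,s,t)=\sum_{\pi\in\mathfrak{S}_{n}}y^{\mathrm{pk}(\pi)+1}z^{\mathrm{ipk}(\pi)+1}s^{\mathrm{des}(\pi)+1}t^{\mathrm{ides}(\pi)+1}. \] Then, writing $P_n=P_{n}^{(\mathrm{pk},\mathrm{ipk},\mathrm{des},\mathrm{ides})}$, the following hold as formal power series identities: (a) \begin{multline*} \frac{1}{(1-s)(1-t)}+\sum_{n=1}^{\infty}\frac{\left(\frac{(1+ys)(1+zt)}{(1-s)(1-t)}\right)^{n+1}P_{n}\left(\frac{(1+y)^{2}s}{(y+s)(1+ys)},\frac{(1+z)^{2}t}{(z+t)(1+zt)},\frac{y+s}{1+ys},\frac{z+t}{1+zt}\right)}{(1+y)(1+z)}x^{n}\\ =\sum_{i,j=0}^{\infty}\left(\frac{(1+yx)(1+zx)}{(1-yzx)(1-x)}\right)^{ij}s^{i}t^{j}; \end{multline*} (b) for all $n\geq1$, \begin{multline*} \frac{\left(\frac{(1+ys)(1+zt)}{(1-s)(1-t)}\right)^{n+1}P_{n}\left(\frac{(1+y)^{2}s}{(y+s)(1+ys)},\frac{(1+z)^{2}t}{(z+t)(1+zt)},\frac{y+s}{1+ys},\frac{z+t}{1+zt}\right)}{(1+y)(1+z)}\\ =\sum_{\lambda\vdash n}\frac{\prod_{i=1}^{l(\lambda)}(1-(-y)^{\lambda_{i}})(1-(-z)^{\lambda_{i}})}{z_{\lambda}}\frac{A_{l(\lambda)}(s)A_{l(\lambda)}(t)}{(1-s)^{l(\lambda)+1}(1-t)^{l(\lambda)+1}},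 \end{multline*} where $\lambda_1,\dots,\lambda_{l(\lambda)}$ are the parts of $\lambda$.
   Context: $\mathfrak{S}_n$ is the symmetric group on $[n]=\{1,\dots,n\}$. For $\pi\in\mathfrak{S}_n$, $i\in[n-1]$ is a descent if $\pi(i)>\pi(i+1)$; $\mathrm{des}(\pi)$ is the number of descents. An index $i$ with $2\le i\le n-1$ is a peak if $\pi(i-1)<\pi(i)>\pi(i+1)$; $\mathrm{pk}(\pi)$ is the number of peaks. For a statistic $\mathrm{st}$, the inverse statistic is $\mathrm{ist}(\pi)=\mathrm{st}(\pi^{-1})$ (so $\mathrm{ides}(\pi)=\mathrm{des}(\pi^{-1})$, $\mathrm{ipk}(\pi)=\mathrm{pk}(\pi^{-1})$). The Eulerian polynomials are $A_n(t)=\sum_{\pi\in\mathfrak{S}_n}t^{\mathrm{des}(\pi)+1}$ for $n\ge1$ and $A_0(t)=1$. For a partition $\lambda$, $l(\lambda)$ is its number of parts, $\lambda\vdash n$ means $\lambda$ is a partition of $n$, and if $\lambda$ has $m_i$ parts equal to $i$ then $z_\lambda=\prod_i i^{m_i}m_i!$. *)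

theory Defs
  imports
    "HOL-Computational_Algebra.Formal_Power_Series"
    "HOL-Computational_Algebra.Polynomial_Factorial"
    "HOL-Combinatorics.Permutations"
    "HOL-Library.Multiset"
begin

(* Permutations of [n] are functions nat => nat that permute {1..n}; such a function does not
   determine n, so des and pk take n as an argument. *)

definition des :: "nat \<Rightarrow> (nat \<Rightarrow> nat) \<Rightarrow> nat" where
  "des n \<pi> = card {i \<in> {1..<n}. \<pi> i > \<pi> (i + 1)}"

definition pk :: "nat \<Rightarrow> (nat \<Rightarrow> nat) \<Rightarrow> nat" where
  "pk n \<pi> = card {i \<in> {2..<n}. \<pi> (i - 1) < \<pi> i \<and> \<pi> i > \<pi> (i + 1)}"

definition ides :: "nat \<Rightarrow> (nat \<Rightarrow> nat) \<Rightarrow> nat" where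
  "ides n \<pi> = des n (inv \<pi>)"

definition ipk :: "nat \<Rightarrow> (nat \<Rightarrow> nat) \<Rightarrow> nat" where
  "ipk n \<pi> = pk n (inv \<pi>)"

definition pk_des_poly :: "nat \<Rightarrow> 'a \<Rightarrow> 'a \<Rightarrow> 'a \<Rightarrow> 'a \<Rightarrow> 'a::comm_semiring_1" where
  "pk_des_poly n y z s t =
     (\<Sum>\<pi> | \<pi> permutes {1..n}.
        y ^ (pk n \<pi> + 1) * z ^ (ipk n \<pi> + 1) * s ^ (des n \<pi> + 1) * t ^ (ides n \<pi> + 1))"

definition eulerian_poly :: "nat \<Rightarrow> 'a \<Rightarrow> 'a::comm_semiring_1" where
  "eulerian_poly n t = (if n = 0 then 1 else (\<Sum>\<pi> | \<pi> permutes {1..n}. t ^ (des n \<pi> + 1)))"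

(* A partition is the multiset of its parts, so l(\<mu>) is its size. *)

definition partitions :: "nat \<Rightarrow> nat multiset set" where
  "partitions n = {\<mu>. 0 \<notin># \<mu> \<and> \<Sum>\<^sub># \<mu> = n}"

definition zee :: "nat multiset \<Rightarrow> nat" where
  "zee \<mu> = (\<Prod>i\<in>set_mset \<mu>. i ^ count \<mu> i * fact (count \<mu> i))"

lemma finite_partitions: "finite (partitions n)"
proof (rule finite_subset)
  have size_le: "0 \<notin># M \<Longrightarrow> size M \<le> \<Sum>\<^sub># M" for M :: "nat multiset"
    by (induction M) auto
  show "partitions n \<subseteq> mset ` {xs. set xs \<subseteq> {..n} \<and> length xs \<le> n}"
  proof
    fix M assume "M \<in> partitions n"
    then have M: "0 \<notin># M" "\<Sum>\<^sub># M = n" by (auto simp: partitions_def)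
    obtain xs where xs: "mset xs = M" using ex_mset by blast
    have "set xs \<subseteq> {..n}"
      using M xs by (auto simp: sum_mset_sum_list dest: member_le_sum_list)
    moreover have "length xs \<le> n"
      using size_le[of M] M xs by auto
    ultimately show "M \<in> mset ` {xs. set xs \<subseteq> {..n} \<and> length xs \<le> n}" using xs by blast
  qed
  show "finite (mset ` {xs. set xs \<subseteq> {..n} \<and> length xs \<le> n})"
    by (intro finite_imageI finite_lists_length_le) simp
qed

(* Q[[y,z,s,t]] is the iterated power series ring rat fps fps fps fps with y innermost and t
   outermost.  The arguments of P_n have the non-units y + s and z + t as denominators, so the
   substitution takes place in the fraction field of Q[[y,z,s,t]], and the series in x have
   coefficients in this field. *)

type_synonym coeff_field = "rat fps fps fps fps fract"

definition vy :: coeff_field where "vy = to_fract (fps_const (fps_const (fps_const fps_X)))"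
definition vz :: coeff_field where "vz = to_fract (fps_const (fps_const fps_X))"
definition vs :: coeff_field where "vs = to_fract (fps_const fps_X)"
definition vt :: coeff_field where "vt = to_fract fps_X"

(* The series (1+yx)(1+zx) / ((1-yzx)(1-x)) in Q[[y,z]][[x]], with x outermost.  The denominator
   has constant term 1 in x, so fps division is genuine division here. *)

definition base_series :: "rat fps fps fps" where
  "base_series =
     (let y = fps_const (fps_const fps_X); z = fps_const fps_X; x = fps_X
      in ((1 + y * x) * (1 + z * x)) / ((1 - y * z * x) * (1 - x)))"

lemma base_series_mult:
  "base_series * ((1 - fps_const (fps_const fps_X) * fps_const fps_X * fps_X) * (1 - fps_X)) =
     (1 + fps_const (fps_const fps_X) * fps_X) * (1 + fps_const fps_X * fps_X)"
proof -
  define g :: "rat fps fps fps"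
    where "g = (1 - fps_const (fps_const fps_X) * fps_const fps_X * fps_X) * (1 - fps_X)"
  have g0: "fps_nth g 0 = 1" by (simp add: g_def)
  have inv1: "inverse (1 :: rat fps fps) = 1"
    by (rule fps_inverse_one') (rule fps_inverse_one)
  have "inverse g = fps_right_inverse g 1"
    by (simp only: fps_inverse_def[of g] g0 inv1)
  then have "inverse g * g = 1"
    using fps_left_inverse'[of 1 g 1] g0 by simp
  then show ?thesis
    unfolding base_series_def Let_def g_def [symmetric]
    by (simp add: fps_divide_unit g0 mult.assoc)
qed

(* The sum over i, j >= 0 of f i j * s^i * t^j, where each f i j is a series in x over the ring
   'a of coefficients, rewritten as a series in x: its coefficient at x^n is the element of
   'a[[s]][[t]] whose coefficient at s^i t^j is the coefficient of f i j at x^n. *)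

definition sum_st :: "(nat \<Rightarrow> nat \<Rightarrow> 'a::idom fps) \<Rightarrow> 'a fps fps fract fps" where
  "sum_st f = Abs_fps (\<lambda>n. to_fract (Abs_fps (\<lambda>j. Abs_fps (\<lambda>i. fps_nth (f i j) n))))"

lemma sum_st_finite:
  fixes f :: "nat \<Rightarrow> nat \<Rightarrow> 'a::idom fps"
  assumes "\<And>i j. i > N \<or> j > N \<Longrightarrow> f i j = 0"
  shows "sum_st f = (\<Sum>i\<le>N. \<Sum>j\<le>N.
           Abs_fps (\<lambda>n. to_fract (fps_const (fps_const (fps_nth (f i j) n)))) *
           fps_const (to_fract (fps_const fps_X) ^ i * to_fract fps_X ^ j))"
proof (rule fps_ext)
  fix n
  have pow: "to_fract x ^ k = to_fract (x ^ k)" for x :: "'a fps fps" and k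
    by (induction k) simp_all
  have sum: "(\<Sum>i\<le>N. to_fract (h i)) = to_fract (sum h {..N})" for h :: "nat \<Rightarrow> 'a fps fps"
    by (induction N) simp_all
  have "Abs_fps (\<lambda>j. Abs_fps (\<lambda>i. fps_nth (f i j) n)) =
      (\<Sum>i\<le>N. \<Sum>j\<le>N.
         fps_const (fps_const (fps_nth (f i j) n)) * (fps_const fps_X ^ i * fps_X ^ j))"
    (is "?A = ?B")
  proof (intro fps_ext)
    fix b a
    have "fps_nth (fps_nth ?B b) a =
        (\<Sum>i\<le>N. \<Sum>j\<le>N. if a = i then if b = j then fps_nth (f i j) n else 0 else 0)"
      by (intro sum.cong refl | simp add: fps_sum_nth fps_X_power_mult_right_nth mult.assoc[symmetric])+
    also have "\<dots> = (if a \<le> N \<and> b \<le> N then fps_nth (f a b) n else 0)"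
    proof -
      have "(\<Sum>j\<le>N. if a = i then if b = j then fps_nth (f i j) n else 0 else 0) =
          (if a = i then if b \<le> N then fps_nth (f i b) n else 0 else 0)" for i
        by (cases "a = i") simp_all
      then show ?thesis by simp
    qed
    finally show "fps_nth (fps_nth ?A b) a = fps_nth (fps_nth ?B b) a"
      using assms[of a b] by (auto simp: not_le)
  qed
  then have "to_fract ?A = to_fract ?B" by (rule arg_cong)
  then show "fps_nth (sum_st f) n = fps_nth (\<Sum>i\<le>N. \<Sum>j\<le>N.
           Abs_fps (\<lambda>n. to_fract (fps_const (fps_const (fps_nth (f i j) n)))) *
           fps_const (to_fract (fps_const fps_X) ^ i * to_fract fps_X ^ j)) n"
    by (simp only: sum_st_def fps_sum_nth pow sum fps_nth_Abs_fps fps_mult_right_const_nth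
          to_fract_mult[symmetric])
qed

end

theory Submission
  imports Defs "HOL-Library.FuncSet"
begin

text \<open>
  Let \<open>K\<^sub>i(\<pi>; y)\<close> be the weighted number of weakly increasing words \<open>f\<close> of length \<open>n\<close> over the alphabet
  \<open>1' < 1 < 2' < 2 < \<dots> < i' < i\<close>, a primed letter having weight \<open>y\<close>, in which \<open>f k = f (k + 1)\<close> is
  allowed for a primed letter only if \<open>k\<close> is a descent of \<open>\<pi>\<close>, and for an unprimed letter only if it
  is not. Reading the word from left to right shows that \<open>\<Sum>\<^sub>i K\<^sub>i(\<pi>; y) s\<^sup>i\<close> is, up to the factor
  \<open>((1 + y s) / (1 - s))\<^sup>n\<^sup>+\<^sup>1 / (1 + y)\<close>, the monomial of \<open>\<pi>\<close> in the substituted peak and descent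
  variables. By standardization, triples of a permutation \<open>\<pi>\<close> and words counted by \<open>K\<^sub>i(\<pi>; y)\<close> and
  \<open>K\<^sub>j(\<pi>\<^sup>-\<^sup>1; z)\<close> are multisets of pairs of letters in which only pairs that are both primed or both
  unprimed may be repeated. Their generating function is the \<open>ij\<close>-th power in (a). Part (b) expands
  this power with Newton's identities; \<open>y = 0\<close> gives the generating function of \<open>i\<^sup>l\<close> in terms of
  the Eulerian polynomial.
\<close>

section \<open>Weighted paths\<close>

text \<open>The relation takes the position as an argument because the descents of a permutation
  decide, position by position, which letters may repeat.\<close>

definition paths :: "'c set \<Rightarrow> (nat \<Rightarrow> 'c \<Rightarrow> 'c \<Rightarrow> bool) \<Rightarrow> nat \<Rightarrow> (nat \<Rightarrow> 'c) set" where
  "paths S Q n = {f \<in> {1..n} \<rightarrow>\<^sub>E S. \<forall>k\<in>{1..<n}. Q k (f k) (f (Suc k))}"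

definition path_sum ::
    "'c set \<Rightarrow> (nat \<Rightarrow> 'c \<Rightarrow> 'c \<Rightarrow> bool) \<Rightarrow> ('c \<Rightarrow> 'a) \<Rightarrow> nat \<Rightarrow> 'a::comm_semiring_1" where
  "path_sum S Q w n = (\<Sum>f\<in>paths S Q n. \<Prod>k=1..n. w (f k))"

text \<open>The last-letter recursion for words ending in \<open>c\<close>. The value 0 at length 0
  says that the empty word has no last letter; this keeps the coefficient identities in
  \<open>path_sum_rank_order\<close> valid at length 0.\<close>

primrec path_end ::
    "'c set \<Rightarrow> (nat \<Rightarrow> 'c \<Rightarrow> 'c \<Rightarrow> bool) \<Rightarrow> ('c \<Rightarrow> 'a) \<Rightarrow> nat \<Rightarrow> 'c \<Rightarrow> 'a::comm_semiring_1" where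
  "path_end S Q w 0 c = 0"
| "path_end S Q w (Suc n) c =
     w c * (if n = 0 then 1 else \<Sum>c' | c' \<in> S \<and> Q n c' c. path_end S Q w n c')"

lemma finite_paths: "finite S \<Longrightarrow> finite (paths S Q n)"
  by (rule finite_subset[of _ "{1..n} \<rightarrow>\<^sub>E S"]) (auto simp: paths_def intro: finite_PiE)

lemma paths_cong:
  assumes "\<And>k. k \<in> {1..<n} \<Longrightarrow> Q k = Q' k"
  shows "paths S Q n = paths S Q' n"
  unfolding paths_def using assms by auto

text \<open>Deleting the last letter maps the words ending in \<open>c\<close> bijectively onto the
  shorter words whose last letter may precede \<open>c\<close>; grouping these by their last letter
  gives the recursion.\<close>

lemma path_end_eq_sum:
  assumes "finite S" "c \<in> S"
  shows "path_end S Q w (Suc n) c =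
    (\<Sum>f | f \<in> paths S Q (Suc n) \<and> f (Suc n) = c. \<Prod>k=1..Suc n. w (f k))"
  using assms(2)
proof (induction n arbitrary: c)
  case 0
  have "{f. f \<in> paths S Q (Suc 0) \<and> f (Suc 0) = c} = {\<lambda>k\<in>{1}. c}"
    using 0 by (auto simp: paths_def PiE_iff extensional_def restrict_def fun_eq_iff)
  then show ?case by simp
next
  case (Suc n)
  let ?P = "\<lambda>c. {f. f \<in> paths S Q (Suc n) \<and> f (Suc n) = c}"
  let ?T = "{f \<in> paths S Q (Suc n). Q (Suc n) (f (Suc n)) c}"
  have fin: "finite (?P c')" for c'
    by (rule finite_subset[OF _ finite_paths[OF assms(1)]]) auto
  have "(\<Sum>f | f \<in> paths S Q (Suc (Suc n)) \<and> f (Suc (Suc n)) = c. \<Prod>k=1..Suc (Suc n). w (f k))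
      = (\<Sum>f\<in>?T. w c * (\<Prod>k=1..Suc n. w (f k)))"
  proof (rule sum.reindex_bij_witness[of _ "\<lambda>f. f(Suc (Suc n) := c)" "\<lambda>f. restrict f {1..Suc n}"])
    fix f assume f: "f \<in> {f. f \<in> paths S Q (Suc (Suc n)) \<and> f (Suc (Suc n)) = c}"
    then have ex: "\<And>k. k \<notin> {1..Suc (Suc n)} \<Longrightarrow> f k = undefined"
      by (auto simp: paths_def PiE_iff extensional_def)
    show "(restrict f {1..Suc n})(Suc (Suc n) := c) = f"
      using f ex by (auto simp: fun_eq_iff restrict_def)
    show "restrict f {1..Suc n} \<in> ?T"
      using f by (auto simp: paths_def PiE_iff)
    have "(\<Prod>k=1..Suc n. w (restrict f {1..Suc n} k)) = (\<Prod>k=1..Suc n. w (f k))"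
      by (intro prod.cong) auto
    then show "w c * (\<Prod>k=1..Suc n. w (restrict f {1..Suc n} k)) = (\<Prod>k=1..Suc (Suc n). w (f k))"
      using f by (simp add: mult_ac)
  next
    fix f assume f: "f \<in> ?T"
    then have ex: "\<And>k. k \<notin> {1..Suc n} \<Longrightarrow> f k = undefined"
      by (auto simp: paths_def PiE_iff extensional_def)
    show "restrict (f(Suc (Suc n) := c)) {1..Suc n} = f"
      using ex by (auto simp: fun_eq_iff restrict_def)
    show "f(Suc (Suc n) := c) \<in> {f. f \<in> paths S Q (Suc (Suc n)) \<and> f (Suc (Suc n)) = c}"
      using f Suc.prems by (auto simp: paths_def PiE_iff extensional_def less_Suc_eq le_Suc_eq)
  qed
  also have "\<dots> = w c * (\<Sum>f\<in>?T. \<Prod>k=1..Suc n. w (f k))"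
    by (simp add: sum_distrib_left)
  also have "?T = (\<Union>c' \<in> {c'\<in>S. Q (Suc n) c' c}. ?P c')"
    by (auto simp: paths_def PiE_iff)
  also have "(\<Sum>f\<in>(\<Union>c' \<in> {c'\<in>S. Q (Suc n) c' c}. ?P c'). \<Prod>k=1..Suc n. w (f k)) =
      (\<Sum>c' | c' \<in> S \<and> Q (Suc n) c' c. \<Sum>f\<in>?P c'. \<Prod>k=1..Suc n. w (f k))"
    by (rule sum.UNION_disjoint) (use assms(1) fin in auto)
  also have "\<dots> = (\<Sum>c' | c' \<in> S \<and> Q (Suc n) c' c. path_end S Q w (Suc n) c')"
    by (intro sum.cong refl) (use Suc.IH in auto)
  finally show ?case by simp
qed

lemma path_sum_0 [simp]: "path_sum S Q w 0 = 1"
proof -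
  have "paths S Q 0 = {\<lambda>_. undefined}" by (auto simp: paths_def)
  then show ?thesis by (simp add: path_sum_def)
qed

lemma path_sum_eq_path_end:
  assumes "finite S" "n > 0"
  shows "path_sum S Q w n = (\<Sum>c\<in>S. path_end S Q w n c)"
proof -
  obtain m where n: "n = Suc m" using assms(2) gr0_conv_Suc by blast
  let ?P = "\<lambda>c. {f. f \<in> paths S Q n \<and> f n = c}"
  have fin: "finite (?P c')" for c'
    by (rule finite_subset[OF _ finite_paths[OF assms(1)]]) auto
  have "paths S Q n = (\<Union>c\<in>S. ?P c)" using assms(2) by (auto simp: paths_def PiE_iff)
  then have "path_sum S Q w n = (\<Sum>f\<in>(\<Union>c\<in>S. ?P c). \<Prod>k=1..n. w (f k))"
    by (simp add: path_sum_def)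
  also have "\<dots> = (\<Sum>c\<in>S. \<Sum>f\<in>?P c. \<Prod>k=1..n. w (f k))"
    by (rule sum.UNION_disjoint) (use assms(1) fin in auto)
  finally have "path_sum S Q w n = (\<Sum>c\<in>S. \<Sum>f\<in>?P c. \<Prod>k=1..n. w (f k))" .
  then show ?thesis
    unfolding n by (simp only: path_end_eq_sum[OF assms(1)] cong: sum.cong)
qed

text \<open>If \<open>S\<close> is closed under predecessors, a word ending in \<open>S\<close>
  never leaves \<open>S\<close>. This serves both for adding a largest letter and for replacing an
  initial segment of letters by all of \<open>UNIV\<close>.\<close>

lemma path_end_mono_set:
  assumes "S \<subseteq> S'" and "\<And>k c c'. c \<in> S \<Longrightarrow> c' \<in> S' \<Longrightarrow> Q k c' c \<Longrightarrow> c' \<in> S" and "c \<in> S"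
  shows "path_end S' Q w n c = path_end S Q w n c"
  using assms(3)
proof (induction n arbitrary: c)
  case (Suc n)
  have "{c'. c' \<in> S' \<and> Q n c' c} = {c'. c' \<in> S \<and> Q n c' c}"
    using assms(1,2) Suc.prems by blast
  then have "(\<Sum>c' | c' \<in> S' \<and> Q n c' c. path_end S' Q w n c') =
      (\<Sum>c' | c' \<in> S \<and> Q n c' c. path_end S Q w n c')"
    using Suc.IH by (intro sum.cong) auto
  then show ?case by simp
qed simp

text \<open>Adding a new largest letter \<open>c\<close> multiplies the generating function by \<open>1 / (1 - w c x)\<close> or
  by \<open>1 + w c x\<close>, according to whether \<open>c\<close> may follow itself.\<close>

lemma path_sum_rank_order:
  fixes w :: "'c \<Rightarrow> 'a::comm_ring_1" and rk :: "'c \<Rightarrow> nat"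
  assumes "finite S" "inj_on rk S"
    and Q: "\<And>k c c'. c \<in> S \<Longrightarrow> c' \<in> S \<Longrightarrow> Q k c c' \<longleftrightarrow> rk c < rk c' \<or> c = c' \<and> rep c"
  shows "Abs_fps (path_sum S Q w) * (\<Prod>c\<in>S. if rep c then 1 - fps_const (w c) * fps_X else 1)
       = (\<Prod>c\<in>S. if rep c then 1 else 1 + fps_const (w c) * fps_X)"
  using assms
proof (induction rule: finite_ranking_induct[where f = rk])
  case empty
  have "path_sum {} Q w n = (if n = 0 then 1 else 0)" for n
    using path_sum_eq_path_end[of "{}" n Q w] by auto
  then have "Abs_fps (path_sum {} Q w) = 1" by (auto simp: fps_eq_iff)
  then show ?case by simp
next
  case (insert c S)
  show ?case
  proof (cases "c \<in> S")
    case True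
    then show ?thesis using insert by (simp add: insert_absorb)
  next
    case False
    let ?S = "insert c S"
    \<comment> \<open>The induction principle only gives a weak inequality; injectivity of
      \<open>rk\<close> makes it strict.\<close>
    have lt: "rk c' < rk c" if "c' \<in> S" for c'
      using insert.hyps(2)[OF that] insert.prems(1) that False
      by (metis inj_on_eq_iff insertCI le_neq_implies_less)
    have IH: "Abs_fps (path_sum S Q w) * (\<Prod>c\<in>S. if rep c then 1 - fps_const (w c) * fps_X else 1)
       = (\<Prod>c\<in>S. if rep c then 1 else 1 + fps_const (w c) * fps_X)"
      using insert.IH insert.prems by (auto simp: inj_on_def)
    have old: "path_end ?S Q w n c' = path_end S Q w n c'" if "c' \<in> S" for n c'
      by (rule path_end_mono_set) (use that lt insert.prems(2) in \<open>auto dest: less_asym\<close>)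
    define C where "C = Abs_fps (\<lambda>n. path_end ?S Q w n c)"
    have T: "path_sum ?S Q w n = path_sum S Q w n + path_end ?S Q w n c" for n
    proof (cases "n = 0")
      case False
      then show ?thesis
        using insert.hyps(1) \<open>c \<notin> S\<close> old by (simp add: path_sum_eq_path_end add.commute)
    qed simp
    \<comment> \<open>A final \<open>c\<close> follows any word over the old letters or, if
      \<open>c\<close> may repeat, also a word ending in \<open>c\<close>. Solving this linear
      equation for the generating function gives the new factor.\<close>
    have "path_end ?S Q w (Suc n) c =
        w c * (path_sum S Q w n + (if rep c then path_end ?S Q w n c else 0))" for n
    proof (cases "n = 0")
      case False
      have "{c'. c' \<in> ?S \<and> Q n c' c} = (if rep c then ?S else S)"
        using insert.prems(2) lt \<open>c \<notin> S\<close> by auto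
      then show ?thesis
        using False insert.hyps(1) \<open>c \<notin> S\<close> old by (simp add: path_sum_eq_path_end add.commute)
    qed simp
    then have C: "C = fps_const (w c) * fps_X * (Abs_fps (path_sum S Q w) + (if rep c then C else 0))"
      by (auto simp: fps_eq_iff C_def mult.assoc fps_X_mult_nth gr0_conv_Suc
          split: nat.splits)
    have T': "Abs_fps (path_sum ?S Q w) = Abs_fps (path_sum S Q w) + C"
      by (simp add: fps_eq_iff T C_def)
    show ?thesis
    proof (cases "rep c")
      case True
      then have "(Abs_fps (path_sum S Q w) + C) * (1 - fps_const (w c) * fps_X) =
         Abs_fps (path_sum S Q w)"
        using C by (simp add: algebra_simps)
      then show ?thesis
        using IH True insert.hyps(1) \<open>c \<notin> S\<close> T' by (simp add: mult.assoc[symmetric])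
    next
      case nr: False
      then have "Abs_fps (path_sum S Q w) + C =
         (1 + fps_const (w c) * fps_X) * Abs_fps (path_sum S Q w)"
        using C by (simp add: algebra_simps)
      then show ?thesis
        using IH nr insert.hyps(1) \<open>c \<notin> S\<close> T' by (simp add: mult.assoc)
    qed
  qed
qed

section \<open>Words compatible with a descent set\<close>

text \<open>The primed letter \<open>a'\<close> is encoded as the even number \<open>2a - 2\<close> and the unprimed letter \<open>a\<close> as
  \<open>2a - 1\<close>; \<open>d k\<close> says that \<open>k\<close> is a descent.\<close>

definition letter_step :: "(nat \<Rightarrow> bool) \<Rightarrow> nat \<Rightarrow> nat \<Rightarrow> nat \<Rightarrow> bool" where
  "letter_step d k c c' \<longleftrightarrow> c < c' \<or> c = c' \<and> (even c \<longleftrightarrow> d k)"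

definition letter_weight :: "'a \<Rightarrow> nat \<Rightarrow> 'a::comm_semiring_1" where
  "letter_weight y c = (if even c then y else 1)"

definition letter_sum :: "'a \<Rightarrow> nat \<Rightarrow> (nat \<Rightarrow> bool) \<Rightarrow> nat \<Rightarrow> 'a::comm_semiring_1" where
  "letter_sum y n d i = path_sum {..<2 * i} (letter_step d) (letter_weight y) n"

lemma sum_lessThan_double:
  "(\<Sum>c<2 * a. f c) = (\<Sum>m<a. f (2 * m + 1) + f (2 * m))" for f :: "nat \<Rightarrow> 'a::comm_monoid_add"
  by (induction a) (simp_all add: add_ac)

lemma fps_one_minus_X_mult_sum:
  fixes f :: "nat \<Rightarrow> 'a::comm_ring_1"
  shows "(1 - fps_X) * Abs_fps (\<lambda>a. \<Sum>m<a. f m) = fps_X * Abs_fps f"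
proof (rule fps_ext)
  fix n
  show "fps_nth ((1 - fps_X) * Abs_fps (\<lambda>a. \<Sum>m<a. f m)) n = fps_nth (fps_X * Abs_fps f) n"
    by (cases n) (simp_all add: left_diff_distrib)
qed

text \<open>Descents and peaks of an abstract descent indicator, so that the induction can run over
  prefixes. For the descents of a permutation the index \<open>k\<close> corresponds to length
  \<open>Suc k\<close>.\<close>

definition run_des :: "nat \<Rightarrow> (nat \<Rightarrow> bool) \<Rightarrow> nat" where
  "run_des k d = card {i \<in> {1..k}. d i}"

definition run_pk :: "nat \<Rightarrow> (nat \<Rightarrow> bool) \<Rightarrow> nat" where
  "run_pk k d = card {i \<in> {2..k}. \<not> d (i - 1) \<and> d i}"

lemma run_des_Suc: "run_des (Suc k) d = run_des k d + (if d (Suc k) then 1 else 0)"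
proof -
  have "{i \<in> {1..Suc k}. d i} = (if d (Suc k) then insert (Suc k) {i \<in> {1..k}. d i} else {i \<in> {1..k}. d i})"
    by (auto simp: le_Suc_eq)
  then show ?thesis by (simp add: run_des_def)
qed

lemma run_pk_Suc:
  "run_pk (Suc k) d = run_pk k d + (if k > 0 \<and> \<not> d k \<and> d (Suc k) then 1 else 0)"
proof -
  have "{i \<in> {2..Suc k}. \<not> d (i - 1) \<and> d i} =
    (if k > 0 \<and> \<not> d k \<and> d (Suc k) then insert (Suc k) {i \<in> {2..k}. \<not> d (i - 1) \<and> d i}
     else {i \<in> {2..k}. \<not> d (i - 1) \<and> d i})"
    by (auto simp: le_Suc_eq)
  then show ?thesis by (simp add: run_pk_def)
qed

lemma run_0 [simp]: "run_des 0 d = 0" "run_pk 0 d = 0"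
  by (simp_all add: run_des_def run_pk_def)

context
  fixes y :: "'a::comm_ring_1" and d :: "nat \<Rightarrow> bool"
begin

text \<open>The alphabet is unbounded, but only finitely many letters may precede a given one, so
  the recursion uses finite sums and does not depend on \<open>i\<close>.\<close>

private abbreviation pe where "pe \<equiv> path_end UNIV (letter_step d) (letter_weight y)"

text \<open>\<open>U\<close> and \<open>V\<close> collect the words of length \<open>k + 1\<close>
  ending in an unprimed and in a primed letter. The coefficient at \<open>a\<close> belongs to the
  letter \<open>a + 1\<close>, whence the extra \<open>fps_X\<close> in
  \<open>letter_sum_gf\<close>.\<close>

private definition U where "U k = Abs_fps (\<lambda>a. pe (Suc k) (2 * a + 1))"
private definition V where "V k = Abs_fps (\<lambda>a. pe (Suc k) (2 * a))"

private abbreviation psum where "psum k \<equiv> Abs_fps (\<lambda>a. \<Sum>m<a. pe (Suc k) (2 * m + 1) + pe (Suc k) (2 * m))"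

private lemma psum: "(1 - fps_X) * psum k = fps_X * (U k + V k)"
  using fps_one_minus_X_mult_sum[of "\<lambda>m. pe (Suc k) (2 * m + 1) + pe (Suc k) (2 * m)"]
  by (simp add: U_def V_def fps_plus_def)

private lemma U_0: "(1 - fps_X) * U 0 = 1" and V_0: "V 0 = fps_const y * U 0"
proof -
  have "U 0 = Abs_fps (\<lambda>_. 1)" by (simp add: U_def letter_weight_def)
  then show "(1 - fps_X) * U 0 = 1"
    by (simp add: fps_eq_iff left_diff_distrib fps_X_mult_nth)
  show "V 0 = fps_const y * U 0" by (simp add: fps_eq_iff U_def V_def letter_weight_def)
qed

private lemma pe_Suc: "pe (Suc (Suc k)) c =
    letter_weight y c * ((\<Sum>c'<c. pe (Suc k) c') + (if even c \<longleftrightarrow> d (Suc k) then pe (Suc k) c else 0))"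
proof -
  have "{c'. c' \<in> UNIV \<and> letter_step d (Suc k) c' c} =
      (if even c \<longleftrightarrow> d (Suc k) then insert c {..<c} else {..<c})"
    by (auto simp: letter_step_def)
  then have "(\<Sum>c' | c' \<in> UNIV \<and> letter_step d (Suc k) c' c. pe (Suc k) c') =
     (\<Sum>c'<c. pe (Suc k) c') + (if even c \<longleftrightarrow> d (Suc k) then pe (Suc k) c else 0)"
    by (simp del: path_end.simps add: add.commute)
  then show ?thesis by (subst path_end.simps) simp
qed

text \<open>At an ascent an unprimed letter may follow itself, its primed version and all smaller
  letters, but a primed letter only smaller ones. Multiplying by \<open>1 - fps_X\<close> removes
  the partial sums.\<close>

private lemma U_asc: assumes "\<not> d (Suc k)"
  shows "(1 - fps_X) * U (Suc k) = U k + V k" "V (Suc k) = fps_const y * (fps_X * U (Suc k))"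
proof -
  have U: "U (Suc k) = psum k + V k + U k"
    using assms by (simp add: fps_eq_iff U_def V_def pe_Suc letter_weight_def sum_lessThan_double
        del: path_end.simps)
  have V: "V (Suc k) = fps_const y * psum k"
    using assms by (simp add: fps_eq_iff V_def pe_Suc letter_weight_def sum_lessThan_double
        del: path_end.simps)
  have "(1 - fps_X) * U (Suc k) = (1 - fps_X) * psum k + (1 - fps_X) * (V k + U k)"
    unfolding U by (simp add: algebra_simps)
  then show 1: "(1 - fps_X) * U (Suc k) = U k + V k"
    unfolding psum by (simp add: algebra_simps)
  have "psum k = fps_X * U (Suc k)"
    using psum[of k] unfolding U by (simp add: algebra_simps)
  then show "V (Suc k) = fps_const y * (fps_X * U (Suc k))" using V by simp
qed

text \<open>At a descent both versions of a letter may follow the primed version and all smaller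
  letters, so they differ only by the weight \<open>y\<close>.\<close>

private lemma U_desc: assumes "d (Suc k)"
  shows "(1 - fps_X) * U (Suc k) = fps_X * U k + V k" "V (Suc k) = fps_const y * U (Suc k)"
proof -
  have U: "U (Suc k) = psum k + V k"
    using assms by (simp add: fps_eq_iff U_def V_def pe_Suc letter_weight_def sum_lessThan_double
        del: path_end.simps)
  show "V (Suc k) = fps_const y * U (Suc k)"
    using assms by (simp add: fps_eq_iff U_def V_def pe_Suc letter_weight_def sum_lessThan_double
        del: path_end.simps)
  have "(1 - fps_X) * U (Suc k) = (1 - fps_X) * psum k + (1 - fps_X) * V k"
    unfolding U by (simp add: algebra_simps)
  then show 1: "(1 - fps_X) * U (Suc k) = fps_X * U k + V k"
    unfolding psum by (simp add: algebra_simps)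
qed

private lemma letter_sum_gf:
  "(1 - fps_X) * Abs_fps (letter_sum y (Suc k) d) = fps_X * (U k + V k)"
proof -
  have "letter_sum y (Suc k) d i = (\<Sum>m<i. pe (Suc k) (2 * m + 1) + pe (Suc k) (2 * m))" for i
  proof -
    have "letter_sum y (Suc k) d i =
        (\<Sum>c<2 * i. path_end {..<2 * i} (letter_step d) (letter_weight y) (Suc k) c)"
      unfolding letter_sum_def by (subst path_sum_eq_path_end) (simp_all del: path_end.simps)
    also have "\<dots> = (\<Sum>c<2 * i. pe (Suc k) c)"
      by (intro sum.cong refl path_end_mono_set[symmetric]) (auto simp: letter_step_def)
    finally show ?thesis by (simp only: sum_lessThan_double)
  qed
  then have "Abs_fps (letter_sum y (Suc k) d) = psum k" by (intro arg_cong[of _ _ Abs_fps] ext)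
  then show ?thesis using psum[of k] by (simp only:)
qed

text \<open>The first letter is treated as if it followed a descent, because \<open>V 0\<close> is
  \<open>y\<close> times \<open>U 0\<close>. This agrees with a descent at position 1 not creating a
  peak.\<close>

private definition st :: "nat \<Rightarrow> bool" where "st k \<longleftrightarrow> k = 0 \<or> d k"

text \<open>The letter at position \<open>k + 1\<close> has generating function \<open>(1, y)\<close> or \<open>(1, y s)\<close> up to a
  common factor, depending on whether the step into it is a descent; so each step multiplies that
  factor by a scalar depending only on the types of two consecutive steps.\<close>

private lemma U_closed:
  defines "Y \<equiv> fps_const y" and "X \<equiv> fps_X"
  shows "(1 - X) ^ Suc k * U k * (1 + Y * X) ^ (run_des k d + run_pk k d + (if st k then 0 else 1)) *
      (Y + X) ^ run_pk k d =
    (1 + Y) ^ (2 * run_pk k d + (if st k then 0 else 1)) * X ^ run_pk k d * (1 + Y * X) ^ k *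
      (Y + X) ^ run_des k d"
    and "V k = (if st k then Y else Y * X) * U k"
proof (induction k)
  case 0
  case 1 show ?case using U_0 by (simp add: st_def X_def)
  case 2 show ?case using V_0 by (simp add: st_def Y_def)
next
  case (Suc k)
  let ?D = "run_des k d" and ?P = "run_pk k d"
  case 1
  show ?case
  \<comment> \<open>The step multiplies \<open>(1 - X)\<close>-normalized \<open>U\<close> by
    \<open>Y + X\<close> for a descent after a descent, by \<open>X * (1 + Y)\<close> for a descent
    after an ascent (a new peak), by \<open>1 + Y\<close> for an ascent after a descent, and by
    \<open>1 + Y * X\<close> for an ascent after an ascent.\<close>
  proof (cases "d (Suc k)")
    case True
    then have U: "(1 - X) * U (Suc k) = X * U k + V k" by (simp add: U_desc X_def)
    show ?thesis
    proof (cases "st k")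
      case T: True
      then have U: "(1 - X) * U (Suc k) = (Y + X) * U k" using U Suc(2) by (simp add: algebra_simps)
      have eqs: "run_des (Suc k) d = Suc ?D" "run_pk (Suc k) d = ?P" "st (Suc k)"
        using True T by (auto simp: run_des_Suc run_pk_Suc st_def)
      have "(1 - X) ^ Suc (Suc k) * U (Suc k) * (1 + Y * X) ^ (Suc ?D + ?P) * (Y + X) ^ ?P
        = (1 - X) ^ Suc k * ((1 - X) * U (Suc k)) * (1 + Y * X) ^ (Suc ?D + ?P) * (Y + X) ^ ?P"
        by (simp add: mult_ac)
      also have "\<dots> = ((1 - X) ^ Suc k * U k * (1 + Y * X) ^ (?D + ?P) * (Y + X) ^ ?P) * ((Y + X) * (1 + Y * X))"
        unfolding U by (simp add: mult_ac)
      also have "\<dots> = (1 + Y) ^ (2 * ?P) * X ^ ?P * (1 + Y * X) ^ k * (Y + X) ^ ?D * ((Y + X) * (1 + Y * X))"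
        using Suc(1) T by simp
      finally show ?thesis
        using eqs by (simp add: mult_ac)
    next
      case T: False
      then have U: "(1 - X) * U (Suc k) = X * (1 + Y) * U k" using U Suc(2) by (simp add: algebra_simps)
      have eqs: "run_des (Suc k) d = Suc ?D" "run_pk (Suc k) d = Suc ?P" "st (Suc k)"
        using True T by (auto simp: run_des_Suc run_pk_Suc st_def)
      have "(1 - X) ^ Suc (Suc k) * U (Suc k) * (1 + Y * X) ^ (Suc ?D + Suc ?P) * (Y + X) ^ Suc ?P
        = (1 - X) ^ Suc k * ((1 - X) * U (Suc k)) * (1 + Y * X) ^ (Suc ?D + Suc ?P) * (Y + X) ^ Suc ?P"
        by (simp add: mult_ac)
      also have "\<dots> = ((1 - X) ^ Suc k * U k * (1 + Y * X) ^ (?D + ?P + 1) * (Y + X) ^ ?P) * ((Y + X) * (1 + Y * X) * X * (1 + Y))"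
        unfolding U by (simp add: mult_ac)
      also have "\<dots> = (1 + Y) ^ (2 * ?P + 1) * X ^ ?P * (1 + Y * X) ^ k * (Y + X) ^ ?D * ((Y + X) * (1 + Y * X) * X * (1 + Y))"
        using Suc(1) T by simp
      finally show ?thesis
        using eqs by (simp add: mult_ac)
    qed
  next
    case False
    then have U: "(1 - X) * U (Suc k) = U k + V k" by (simp add: U_asc X_def)
    show ?thesis
    proof (cases "st k")
      case T: True
      then have U: "(1 - X) * U (Suc k) = (1 + Y) * U k" using U Suc(2) by (simp add: algebra_simps)
      have eqs: "run_des (Suc k) d = ?D" "run_pk (Suc k) d = ?P" "\<not> st (Suc k)"
        using False T by (auto simp: run_des_Suc run_pk_Suc st_def)
      have "(1 - X) ^ Suc (Suc k) * U (Suc k) * (1 + Y * X) ^ (?D + ?P + 1) * (Y + X) ^ ?P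
        = (1 - X) ^ Suc k * ((1 - X) * U (Suc k)) * (1 + Y * X) ^ (?D + ?P + 1) * (Y + X) ^ ?P"
        by (simp add: mult_ac)
      also have "\<dots> = ((1 - X) ^ Suc k * U k * (1 + Y * X) ^ (?D + ?P) * (Y + X) ^ ?P) * ((1 + Y) * (1 + Y * X))"
        unfolding U by (simp add: mult_ac)
      also have "\<dots> = (1 + Y) ^ (2 * ?P) * X ^ ?P * (1 + Y * X) ^ k * (Y + X) ^ ?D * ((1 + Y) * (1 + Y * X))"
        using Suc(1) T by simp
      finally show ?thesis
        using eqs by (simp add: mult_ac)
    next
      case T: False
      then have U: "(1 - X) * U (Suc k) = (1 + Y * X) * U k" using U Suc(2) by (simp add: algebra_simps)
      have eqs: "run_des (Suc k) d = ?D" "run_pk (Suc k) d = ?P" "\<not> st (Suc k)"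
        using False T by (auto simp: run_des_Suc run_pk_Suc st_def)
      have "(1 - X) ^ Suc (Suc k) * U (Suc k) * (1 + Y * X) ^ (?D + ?P + 1) * (Y + X) ^ ?P
        = (1 - X) ^ Suc k * ((1 - X) * U (Suc k)) * (1 + Y * X) ^ (?D + ?P + 1) * (Y + X) ^ ?P"
        by (simp add: mult_ac)
      also have "\<dots> = ((1 - X) ^ Suc k * U k * (1 + Y * X) ^ (?D + ?P + 1) * (Y + X) ^ ?P) * (1 + Y * X)"
        unfolding U by (simp add: mult_ac)
      also have "\<dots> = (1 + Y) ^ (2 * ?P + 1) * X ^ ?P * (1 + Y * X) ^ k * (Y + X) ^ ?D * (1 + Y * X)"
        using Suc(1) T by simp
      finally show ?thesis
        using eqs by (simp add: mult_ac)
    qed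
  qed
  case 2
  show ?case
    by (cases "d (Suc k)") (simp_all add: U_desc U_asc st_def X_def Y_def mult.assoc)
qed

text \<open>Summing over the last letter contributes \<open>X * (1 + Y)\<close> after a descent and
  \<open>X * (1 + Y * X)\<close> after an ascent, which removes the dependence on the type of the
  last step. The identity is kept free of division because \<open>Y + X\<close> need not be a
  unit.\<close>

lemma letter_sum_closed:
  defines "Y \<equiv> fps_const y" and "X \<equiv> fps_X"
  shows "(1 - X) ^ Suc (Suc k) * Abs_fps (letter_sum y (Suc k) d) *
      (1 + Y * X) ^ (run_des k d + run_pk k d + 1) * (Y + X) ^ run_pk k d =
    (1 + Y) ^ (2 * run_pk k d + 1) * X ^ (run_pk k d + 1) * (1 + Y * X) ^ Suc k * (Y + X) ^ run_des k d"
proof -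
  let ?D = "run_des k d" and ?P = "run_pk k d"
  let ?G = "Abs_fps (letter_sum y (Suc k) d)"
  note closed = U_closed[of k, folded Y_def X_def]
  have G: "(1 - X) * ?G = X * (U k + V k)" using letter_sum_gf by (simp add: X_def)
  show ?thesis
  proof (cases "st k")
    case T: True
    then have U: "(1 - X) * ?G = X * (1 + Y) * U k" using G closed(2) by (simp add: algebra_simps)
    have "(1 - X) ^ Suc (Suc k) * ?G * (1 + Y * X) ^ (?D + ?P + 1) * (Y + X) ^ ?P
      = (1 - X) ^ Suc k * ((1 - X) * ?G) * (1 + Y * X) ^ (?D + ?P + 1) * (Y + X) ^ ?P"
      by (simp add: mult_ac)
    also have "\<dots> = ((1 - X) ^ Suc k * U k * (1 + Y * X) ^ (?D + ?P) * (Y + X) ^ ?P) * (X * (1 + Y) * (1 + Y * X))"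
      unfolding U by (simp add: mult_ac)
    also have "\<dots> = (1 + Y) ^ (2 * ?P) * X ^ ?P * (1 + Y * X) ^ k * (Y + X) ^ ?D * (X * (1 + Y) * (1 + Y * X))"
      using closed(1) T by simp
    finally show ?thesis by (simp add: mult_ac)
  next
    case T: False
    then have U: "(1 - X) * ?G = X * (1 + Y * X) * U k" using G closed(2) by (simp add: algebra_simps)
    have "(1 - X) ^ Suc (Suc k) * ?G * (1 + Y * X) ^ (?D + ?P + 1) * (Y + X) ^ ?P
      = (1 - X) ^ Suc k * ((1 - X) * ?G) * (1 + Y * X) ^ (?D + ?P + 1) * (Y + X) ^ ?P"
      by (simp add: mult_ac)
    also have "\<dots> = ((1 - X) ^ Suc k * U k * (1 + Y * X) ^ (?D + ?P + 1) * (Y + X) ^ ?P) * (X * (1 + Y * X))"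
      unfolding U by (simp add: mult_ac)
    also have "\<dots> = (1 + Y) ^ (2 * ?P + 1) * X ^ ?P * (1 + Y * X) ^ k * (Y + X) ^ ?D * (X * (1 + Y * X))"
      using closed(1) T by simp
    finally show ?thesis by (simp add: mult_ac)
  qed
qed

end

abbreviation descends :: "(nat \<Rightarrow> nat) \<Rightarrow> nat \<Rightarrow> bool" where
  "descends \<pi> k \<equiv> \<pi> (Suc k) < \<pi> k"

lemma run_des_descends: "run_des k (descends \<pi>) = des (Suc k) \<pi>"
  unfolding run_des_def des_def by (rule arg_cong[of _ _ card]) auto

text \<open>Injectivity turns a non-descent into a strict ascent.\<close>

lemma run_pk_descends:
  assumes "inj \<pi>"
  shows "run_pk k (descends \<pi>) = pk (Suc k) \<pi>"
proof -
  have "\<not> descends \<pi> (i - 1) \<longleftrightarrow> \<pi> (i - 1) < \<pi> i" if "i \<ge> 2" for i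
    using injD[OF assms, of i "i - 1"] that by (cases i) (auto simp: not_less le_less)
  then show ?thesis
    unfolding run_pk_def pk_def by (intro arg_cong[of _ _ card]) auto
qed

lemma letter_sum_gf_permutation:
  fixes y :: "'a::comm_ring_1"
  assumes "n > 0" "inj \<pi>"
  defines "Y \<equiv> fps_const y" and "X \<equiv> fps_X"
  shows "(1 - X) ^ (n + 1) * Abs_fps (letter_sum y n (descends \<pi>)) *
      (1 + Y * X) ^ (des n \<pi> + pk n \<pi> + 1) * (Y + X) ^ pk n \<pi> =
    (1 + Y) ^ (2 * pk n \<pi> + 1) * X ^ (pk n \<pi> + 1) * (1 + Y * X) ^ n * (Y + X) ^ des n \<pi>"
proof -
  obtain k where n: "n = Suc k" using assms(1) gr0_conv_Suc by blast
  show ?thesis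
    using letter_sum_closed[of k y "descends \<pi>"]
    by (simp only: run_des_descends run_pk_descends[OF assms(2)] n Y_def X_def Suc_eq_plus1[symmetric])
qed

section \<open>Standardization\<close>

text \<open>The strict order in which standardization numbers the positions of the word
  \<open>b\<close>. Ties between primed letters are broken from right to left because their plateaus
  must consist of descents.\<close>

definition prec :: "(nat \<Rightarrow> nat) \<Rightarrow> nat \<Rightarrow> nat \<Rightarrow> bool" where
  "prec b k l \<longleftrightarrow> b k < b l \<or> b k = b l \<and> (if even (b k) then l < k else k < l)"

lemma prec_irrefl: "\<not> prec b k k"
  and prec_trans: "prec b k l \<Longrightarrow> prec b l m \<Longrightarrow> prec b k m"
  and prec_total: "k \<noteq> l \<Longrightarrow> prec b k l \<or> prec b l k"
  by (auto simp: prec_def split: if_splits)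

lemma prec_cong:
  "b k = b' k \<Longrightarrow> b l = b' l \<Longrightarrow> prec b k l = prec b' k l"
  by (simp add: prec_def)

lemma prec_Suc: "prec b (Suc k) k = (b (Suc k) < b k \<or> b k = b (Suc k) \<and> even (b k))"
  by (auto simp: prec_def)

text \<open>Such a word is weakly increasing, so equal letters at \<open>p\<close> and
  \<open>q\<close> force a plateau in between, and every step of the plateau has the descent type
  prescribed by the parity.\<close>

lemma paths_letter_stepD:
  assumes g: "g \<in> paths S (letter_step d) n" and "1 \<le> p" "p < q" "q \<le> n"
  shows "g p < g q \<or> g p = g q \<and> (\<forall>k\<in>{p..<q}. even (g p) \<longleftrightarrow> d k)"
  using Suc_leI[OF \<open>p < q\<close>] \<open>q \<le> n\<close>
proof (induction q rule: dec_induct)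
  case base
  have "letter_step d p (g p) (g (Suc p))" using g assms base by (auto simp: paths_def)
  then show ?case by (auto simp: letter_step_def)
next
  case (step q)
  have "letter_step d q (g q) (g (Suc q))" using g assms step by (auto simp: paths_def)
  then show ?case using step by (auto simp: letter_step_def less_Suc_eq)
qed

lemma antitone_chain:
  fixes h :: "nat \<Rightarrow> nat"
  assumes "p < q" "\<forall>k\<in>{p..<q}. h (Suc k) < h k"
  shows "h q < h p"
  using Suc_leI[OF assms(1)] assms(2)
proof (induction q rule: dec_induct)
  case (step q)
  then show ?case by (meson Suc_le_lessD atLeastLessThan_iff lessI less_SucI less_or_eq_imp_le less_trans)
qed simp

lemma monotone_chain:
  fixes h :: "nat \<Rightarrow> nat"
  assumes "p < q" "\<forall>k\<in>{p..<q}. h k < h (Suc k)"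
  shows "h p < h q"
  using Suc_leI[OF assms(1)] assms(2)
proof (induction q rule: dec_induct)
  case (step q)
  then show ?case by (meson Suc_le_lessD atLeastLessThan_iff lessI less_SucI less_or_eq_imp_le less_trans)
qed simp

text \<open>On a plateau of \<open>g\<close> the inverse of \<open>\<pi>\<close> is decreasing for
  an even letter and increasing for an odd one, which is the tie rule of \<open>prec\<close>. The
  converse follows since values of \<open>\<pi>\<close> are totally ordered and \<open>prec\<close>
  is a strict order.\<close>

lemma standardization_less:
  assumes p: "\<pi> permutes {1..n}" and g: "g \<in> paths S (letter_step (descends (inv \<pi>))) n"
    and kl: "k \<in> {1..n}" "l \<in> {1..n}"
  shows "\<pi> k < \<pi> l \<longleftrightarrow> prec (g \<circ> \<pi>) k l"
proof -
  have imp: "prec (g \<circ> \<pi>) k l" if kl: "k \<in> {1..n}" "l \<in> {1..n}" and lt: "\<pi> k < \<pi> l" for k l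
  proof -
    have in_n: "\<pi> k \<in> {1..n}" "\<pi> l \<in> {1..n}" using permutes_in_image[OF p] kl by auto
    have "g (\<pi> k) < g (\<pi> l) \<or> g (\<pi> k) = g (\<pi> l) \<and>
        (\<forall>m\<in>{\<pi> k..<\<pi> l}. even (g (\<pi> k)) \<longleftrightarrow> descends (inv \<pi>) m)"
      using paths_letter_stepD[OF g] in_n lt by auto
    moreover have "(if even (g (\<pi> k)) then l < k else k < l)"
      if *: "\<forall>m\<in>{\<pi> k..<\<pi> l}. even (g (\<pi> k)) \<longleftrightarrow> descends (inv \<pi>) m"
    proof (cases "even (g (\<pi> k))")
      case True
      then have "inv \<pi> (\<pi> l) < inv \<pi> (\<pi> k)" using * by (intro antitone_chain[OF lt]) auto
      then show ?thesis using True permutes_inverses(2)[OF p] by simp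
    next
      case False
      have "inv \<pi> m \<noteq> inv \<pi> (Suc m)" for m
        using permutes_inj[OF permutes_inv[OF p]] by (metis injD n_not_Suc_n)
      then have "inv \<pi> (\<pi> k) < inv \<pi> (\<pi> l)"
        using * False by (intro monotone_chain[OF lt]) (auto simp: not_less le_less)
      then show ?thesis using False permutes_inverses(2)[OF p] by simp
    qed
    ultimately show ?thesis by (auto simp: prec_def)
  qed
  show ?thesis
  proof
    assume pr: "prec (g \<circ> \<pi>) k l"
    show "\<pi> k < \<pi> l"
    proof (rule ccontr)
      assume "\<not> \<pi> k < \<pi> l"
      then have "\<pi> l < \<pi> k \<or> k = l" using permutes_inj[OF p] by (metis injD linorder_neqE_nat)
      then show False using imp[of l k] kl pr prec_irrefl prec_trans by blast
    qed
  qed (use imp kl in blast)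
qed

text \<open>The relative order of the values suffices: each value is one more than the number of
  positions carrying smaller values.\<close>

lemma permutes_eqI_less:
  fixes \<pi> \<sigma> :: "nat \<Rightarrow> nat"
  assumes p: "\<pi> permutes {1..n}" and q: "\<sigma> permutes {1..n}"
    and less: "\<And>k l. k \<in> {1..n} \<Longrightarrow> l \<in> {1..n} \<Longrightarrow> \<pi> k < \<pi> l \<longleftrightarrow> \<sigma> k < \<sigma> l"
  shows "\<pi> = \<sigma>"
proof
  fix k
  have rank: "\<tau> k = Suc (card {l \<in> {1..n}. \<tau> l < \<tau> k})" if t: "\<tau> permutes {1..n}" and k: "k \<in> {1..n}" for \<tau>
  proof -
    have "\<tau> ` {l \<in> {1..n}. \<tau> l < \<tau> k} = {1..<\<tau> k}"
    proof
      show "{1..<\<tau> k} \<subseteq> \<tau> ` {l \<in> {1..n}. \<tau> l < \<tau> k}"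
      proof
        fix m assume m: "m \<in> {1..<\<tau> k}"
        have "\<tau> k \<in> {1..n}" using permutes_in_image[OF t] k by simp
        then have "m \<in> \<tau> ` {1..n}" using permutes_image[OF t] m by auto
        then show "m \<in> \<tau> ` {l \<in> {1..n}. \<tau> l < \<tau> k}" using m by auto
      qed
      show "\<tau> ` {l \<in> {1..n}. \<tau> l < \<tau> k} \<subseteq> {1..<\<tau> k}"
        using permutes_in_image[OF t] by force
    qed
    then have "card {l \<in> {1..n}. \<tau> l < \<tau> k} = card {1..<\<tau> k}"
      using card_image[of \<tau> "{l \<in> {1..n}. \<tau> l < \<tau> k}"] permutes_inj_on[OF t] by metis
    moreover have "\<tau> k \<ge> 1" using permutes_in_image[OF t, of k] k by simp
    ultimately show ?thesis by simp
  qed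
  show "\<pi> k = \<sigma> k"
  proof (cases "k \<in> {1..n}")
    case True
    then have "{l \<in> {1..n}. \<pi> l < \<pi> k} = {l \<in> {1..n}. \<sigma> l < \<sigma> k}" using less by blast
    then show ?thesis using rank[OF p True] rank[OF q True] by simp
  next
    case False
    then show ?thesis using p q by (simp add: permutes_not_in)
  qed
qed

lemma ex_standardization:
  "\<exists>\<pi>. \<pi> permutes {1..n} \<and> (\<forall>k\<in>{1..n}. \<forall>l\<in>{1..n}. \<pi> k < \<pi> l \<longleftrightarrow> prec b k l)"
proof -
  \<comment> \<open>Each position is sent to its rank under \<open>prec b\<close>; counting the
    position itself makes the ranks start at 1.\<close>
  define \<pi> where "\<pi> k = (if k \<in> {1..n} then card {l \<in> {1..n}. l = k \<or> prec b l k} else k)" for k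
  have less: "\<pi> k < \<pi> l" if "k \<in> {1..n}" "l \<in> {1..n}" "prec b k l" for k l
  proof -
    have "{m \<in> {1..n}. m = k \<or> prec b m k} \<subset> {m \<in> {1..n}. m = l \<or> prec b m l}"
    proof (rule psubsetI)
      show "{m \<in> {1..n}. m = k \<or> prec b m k} \<subseteq> {m \<in> {1..n}. m = l \<or> prec b m l}"
        using that prec_trans by blast
      have "l \<in> {m \<in> {1..n}. m = l \<or> prec b m l}" "l \<notin> {m \<in> {1..n}. m = k \<or> prec b m k}"
        using that prec_irrefl prec_trans by blast+
      then show "{m \<in> {1..n}. m = k \<or> prec b m k} \<noteq> {m \<in> {1..n}. m = l \<or> prec b m l}"
        by blast
    qed
    then show ?thesis using that by (simp add: \<pi>_def psubset_card_mono)
  qed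
  have iff: "\<pi> k < \<pi> l \<longleftrightarrow> prec b k l" if "k \<in> {1..n}" "l \<in> {1..n}" for k l
    using less[of k l] less[of l k] that prec_total[of k l b] by (metis less_asym less_irrefl)
  have inj: "inj_on \<pi> {1..n}"
    by (rule inj_onI) (metis less less_irrefl prec_total)
  have "\<pi> k \<in> {1..n}" if k: "k \<in> {1..n}" for k
  proof -
    have "card {l \<in> {1..n}. l = k \<or> prec b l k} \<le> card {1..n}" by (rule card_mono) auto
    moreover have "card {k} \<le> card {l \<in> {1..n}. l = k \<or> prec b l k}"
      using k by (intro card_mono) auto
    ultimately show ?thesis using k by (simp add: \<pi>_def)
  qed
  then have "\<pi> ` {1..n} = {1..n}"
    by (intro card_subset_eq) (use card_image[OF inj] in auto)
  then have "\<pi> permutes {1..n}"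
    by (intro bij_imp_permutes bij_betw_imageI inj) (auto simp: \<pi>_def)
  then show ?thesis using iff by blast
qed

text \<open>Every word is \<open>g \<circ> \<pi>\<close> for a unique permutation \<open>\<pi>\<close> and a unique weakly increasing \<open>g\<close> whose
  plateaus are compatible with the descents of \<open>\<pi>\<^sup>-\<^sup>1\<close>; equal odd letters are numbered from left to
  right, equal even letters from right to left.\<close>

lemma bij_betw_standardization:
  "bij_betw (\<lambda>(\<pi>, g). restrict (g \<circ> \<pi>) {1..n})
     (SIGMA \<pi>:{\<pi>. \<pi> permutes {1..n}}. paths S (letter_step (descends (inv \<pi>))) n)
     ({1..n} \<rightarrow>\<^sub>E S)"
proof (rule bij_betw_imageI)
  let ?D = "SIGMA \<pi>:{\<pi>. \<pi> permutes {1..n}}. paths S (letter_step (descends (inv \<pi>))) n"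
  let ?F = "\<lambda>(\<pi>, g). restrict (g \<circ> \<pi>) {1..n}"
  show "inj_on ?F ?D"
  proof (rule inj_onI)
    fix x x' assume x: "x \<in> ?D" "x' \<in> ?D" "?F x = ?F x'"
    obtain \<pi> g \<sigma> h where xx: "x = (\<pi>, g)" "x' = (\<sigma>, h)" by fastforce
    have p: "\<pi> permutes {1..n}" and q: "\<sigma> permutes {1..n}"
      and g: "g \<in> paths S (letter_step (descends (inv \<pi>))) n"
      and h: "h \<in> paths S (letter_step (descends (inv \<sigma>))) n"
      and eq: "restrict (g \<circ> \<pi>) {1..n} = restrict (h \<circ> \<sigma>) {1..n}"
      using x unfolding xx by auto
    have eq': "(g \<circ> \<pi>) k = (h \<circ> \<sigma>) k" if "k \<in> {1..n}" for k
      using eq that by (metis restrict_apply')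
    have \<pi>: "\<pi> = \<sigma>"
      by (rule permutes_eqI_less[OF p q])
        (use standardization_less[OF p g] standardization_less[OF q h] eq' prec_cong in metis)
    moreover have "g m = h m" for m
    proof (cases "m \<in> {1..n}")
      case True
      then have "inv \<pi> m \<in> {1..n}" using permutes_in_image[OF permutes_inv[OF p]] by simp
      then show ?thesis using eq' \<pi> permutes_inverses(1)[OF p] by force
    next
      case False
      then show ?thesis using g h by (auto simp: paths_def PiE_iff extensional_def)
    qed
    ultimately show "x = x'" unfolding xx by auto
  qed
  show "?F ` ?D = {1..n} \<rightarrow>\<^sub>E S"
  proof
    show "?F ` ?D \<subseteq> {1..n} \<rightarrow>\<^sub>E S"
    proof clarify
      fix \<pi> g assume p: "\<pi> permutes {1..n}" and g: "g \<in> paths S (letter_step (descends (inv \<pi>))) n"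
      show "restrict (g \<circ> \<pi>) {1..n} \<in> {1..n} \<rightarrow>\<^sub>E S"
        using g permutes_in_image[OF p] by (auto simp: paths_def PiE_iff simp del: atLeastAtMost_iff)
    qed
    show "{1..n} \<rightarrow>\<^sub>E S \<subseteq> ?F ` ?D"
    proof
      fix b assume b: "b \<in> {1..n} \<rightarrow>\<^sub>E S"
      obtain \<pi> where p: "\<pi> permutes {1..n}"
        and less: "\<And>k l. k \<in> {1..n} \<Longrightarrow> l \<in> {1..n} \<Longrightarrow> \<pi> k < \<pi> l \<longleftrightarrow> prec b k l"
        using ex_standardization[of n b] by blast
      \<comment> \<open>Reading \<open>b\<close> in the order of its standardization sorts it.
        Positions of consecutive ranks are related by \<open>prec\<close>, whose tie rule is the
        plateau condition.\<close>
      define g where "g = restrict (b \<circ> inv \<pi>) {1..n}"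
      have inv_in: "inv \<pi> m \<in> {1..n}" if "m \<in> {1..n}" for m
        using permutes_in_image[OF permutes_inv[OF p]] that by simp
      have "letter_step (descends (inv \<pi>)) k (g k) (g (Suc k))" if k: "k \<in> {1..<n}" for k
      proof -
        have "prec b (inv \<pi> k) (inv \<pi> (Suc k))"
          using less[of "inv \<pi> k" "inv \<pi> (Suc k)"] inv_in[of k] inv_in[of "Suc k"] k
            permutes_inverses(1)[OF p] by auto
        then show ?thesis
          using k by (auto simp: letter_step_def g_def prec_def split: if_splits)
      qed
      then have "g \<in> paths S (letter_step (descends (inv \<pi>))) n"
        using b inv_in by (auto simp: paths_def g_def PiE_iff simp del: atLeastAtMost_iff)
      moreover have "b = restrict (g \<circ> \<pi>) {1..n}"
      proof
        fix k
        show "b k = restrict (g \<circ> \<pi>) {1..n} k"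
          using b permutes_in_image[OF p, of k] permutes_inverses(2)[OF p, of k]
          by (cases "k \<in> {1..n}") (auto simp: g_def PiE_iff extensional_def simp del: atLeastAtMost_iff)
      qed
      ultimately show "b \<in> ?F ` ?D" using p by force
    qed
  qed
qed

text \<open>The pair of \<open>\<pi>\<close> and a compatible \<open>g\<close> becomes one arbitrary
  word of the same weight, from which \<open>prec\<close> reads off the descents of
  \<open>\<pi>\<close>. \<open>H\<close> may be any quantity depending only on these descents; it is
  used with a letter sum and with the constant 1.\<close>

lemma sum_permutations_standardization:
  fixes w :: "nat \<Rightarrow> 'a::comm_semiring_1"
  assumes "finite S"
    and H: "\<And>d d'. (\<And>k. k \<in> {1..<n} \<Longrightarrow> d k = d' k) \<Longrightarrow> H d = H d'"
  shows "(\<Sum>\<pi> | \<pi> permutes {1..n}.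
      H (descends \<pi>) * path_sum S (letter_step (descends (inv \<pi>))) w n) =
    (\<Sum>b\<in>{1..n} \<rightarrow>\<^sub>E S. H (\<lambda>k. prec b (Suc k) k) * (\<Prod>k=1..n. w (b k)))"
proof -
  let ?D = "SIGMA \<pi>:{\<pi>. \<pi> permutes {1..n}}. paths S (letter_step (descends (inv \<pi>))) n"
  let ?H = "\<lambda>b. H (\<lambda>k. prec b (Suc k) k) * (\<Prod>k=1..n. w (b k))"
  have "(\<Sum>\<pi> | \<pi> permutes {1..n}.
      H (descends \<pi>) * path_sum S (letter_step (descends (inv \<pi>))) w n) =
    (\<Sum>(\<pi>, g)\<in>?D. H (descends \<pi>) * (\<Prod>k=1..n. w (g k)))"
    unfolding path_sum_def[of S] sum_distrib_left
    by (rule sum.Sigma)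
      (use finite_paths[OF assms(1)] finite_permutations[OF finite_atLeastAtMost[of 1 n]] in auto)
  also have "\<dots> = (\<Sum>x\<in>?D. ?H ((\<lambda>(\<pi>, g). restrict (g \<circ> \<pi>) {1..n}) x))"
  proof (rule sum.cong[OF refl])
    fix x assume x: "x \<in> ?D"
    obtain \<pi> g where xx: "x = (\<pi>, g)" by fastforce
    have p: "\<pi> permutes {1..n}" and g: "g \<in> paths S (letter_step (descends (inv \<pi>))) n"
      using x unfolding xx by auto
    let ?b = "restrict (g \<circ> \<pi>) {1..n}"
    have "H (descends \<pi>) = H (\<lambda>k. prec ?b (Suc k) k)"
    proof (rule H)
      fix k assume "k \<in> {1..<n}"
      then show "descends \<pi> k = prec ?b (Suc k) k"
        using standardization_less[OF p g, of "Suc k" k] prec_cong[of "g \<circ> \<pi>" "Suc k" ?b k] by auto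
    qed
    moreover have "(\<Prod>k=1..n. w (g k)) = (\<Prod>k=1..n. w (?b k))"
      unfolding prod.permute[OF p, of "\<lambda>k. w (g k)"] by (rule prod.cong) auto
    ultimately have "H (descends \<pi>) * (\<Prod>k=1..n. w (g k)) = ?H ?b"
      by simp
    then show "(case x of (\<pi>, g) \<Rightarrow> H (descends \<pi>) * (\<Prod>k=1..n. w (g k))) =
        ?H ((\<lambda>(\<pi>, g). restrict (g \<circ> \<pi>) {1..n}) x)"
      unfolding xx prod.case .
  qed
  also have "\<dots> = (\<Sum>b\<in>{1..n} \<rightarrow>\<^sub>E S. ?H b)"
    by (rule sum.reindex_bij_betw[OF bij_betw_standardization])
  finally show ?thesis .
qed

section \<open>Biwords as paths over pairs of letters\<close>

definition pair_step :: "nat \<Rightarrow> nat \<times> nat \<Rightarrow> nat \<times> nat \<Rightarrow> bool" where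
  "pair_step k = (\<lambda>(a, b) (a', b'). letter_step (\<lambda>_. b' < b \<or> b = b' \<and> even b) k a a')"

text \<open>By \<open>prec_Suc\<close>, the descent condition at \<open>k\<close> involves only two
  neighbouring letters of the second word, so the two words merge into one path over pairs.\<close>

lemma sum_words_eq_path_sum_pairs:
  fixes v w :: "nat \<Rightarrow> 'a::comm_semiring_1"
  assumes "finite A" "finite B"
  shows "(\<Sum>b\<in>{1..n} \<rightarrow>\<^sub>E B. path_sum A (letter_step (\<lambda>k. prec b (Suc k) k)) v n * (\<Prod>k=1..n. w (b k))) =
    path_sum (A \<times> B) pair_step (\<lambda>(a, b). v a * w b) n"
proof -
  have "(\<Sum>b\<in>{1..n} \<rightarrow>\<^sub>E B. path_sum A (letter_step (\<lambda>k. prec b (Suc k) k)) v n * (\<Prod>k=1..n. w (b k))) =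
    (\<Sum>(b, f)\<in>(SIGMA b:{1..n} \<rightarrow>\<^sub>E B. paths A (letter_step (\<lambda>k. prec b (Suc k) k)) n).
       (\<Prod>k=1..n. v (f k)) * (\<Prod>k=1..n. w (b k)))"
    unfolding path_sum_def sum_distrib_right
    by (rule sum.Sigma) (use finite_paths[OF assms(1)] assms(2) in \<open>auto intro: finite_PiE\<close>)
  also have "\<dots> = path_sum (A \<times> B) pair_step (\<lambda>(a, b). v a * w b) n"
    unfolding path_sum_def
  proof (rule sum.reindex_bij_witness[of _ "\<lambda>h. (\<lambda>k\<in>{1..n}. snd (h k), \<lambda>k\<in>{1..n}. fst (h k))"
        "\<lambda>(b, f). \<lambda>k\<in>{1..n}. (f k, b k)"], goal_cases)
    case (5 x)
    then show ?case
      by (cases x) (auto simp: prod.distrib[symmetric] intro!: prod.cong)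
  qed (auto simp: paths_def PiE_iff pair_step_def letter_step_def prec_Suc extensional_def fun_eq_iff
      split_beta mem_Times_iff prod_eq_iff)
  finally show ?thesis .
qed

lemma prod_parity:
  "(\<Prod>c<2 * i. f (even c)) = (f True * f False) ^ i" for f :: "bool \<Rightarrow> 'a::comm_monoid_mult"
  by (induction i) (simp_all add: mult_ac)

lemma prod_parity_pairs:
  fixes f :: "bool \<Rightarrow> bool \<Rightarrow> 'a::comm_monoid_mult"
  shows "(\<Prod>(a, b)\<in>{..<2 * i} \<times> {..<2 * j}. f (even a) (even b)) =
    (f True True * f True False * (f False True * f False False)) ^ (i * j)"
proof -
  have "(\<Prod>(a, b)\<in>{..<2 * i} \<times> {..<2 * j}. f (even a) (even b)) =
      (\<Prod>a<2 * i. \<Prod>b<2 * j. f (even a) (even b))"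
    by (simp add: prod.cartesian_product)
  also have "\<dots> = (\<Prod>a<2 * i. (f (even a) True * f (even a) False) ^ j)"
    by (simp add: prod_parity)
  also have "\<dots> = ((f True True * f True False) ^ j * (f False True * f False False) ^ j) ^ i"
    by (rule prod_parity)
  finally show ?thesis by (simp add: power_mult_distrib power_mult mult.commute[of i j])
qed

text \<open>Blocks of length \<open>M\<close>, one for each first letter; in a block with even first
  letter the second letters run backwards. In this order \<open>pair_step\<close> is an increase or
  an admissible repetition, as \<open>path_sum_rank_order\<close> requires.\<close>

definition pair_rank :: "nat \<Rightarrow> nat \<times> nat \<Rightarrow> nat" where
  "pair_rank M = (\<lambda>(a, b). a * M + (if even a then M - 1 - b else b))"

lemma pair_rank_less:
  assumes "b < M" "b' < M" "a < a'"
  shows "pair_rank M (a, b) < pair_rank M (a', b')"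
proof -
  have "Suc a * M \<le> a' * M" using assms(3) by (intro mult_right_mono) auto
  then show ?thesis using assms(1,2) by (auto simp: pair_rank_def)
qed

lemma pair_rank_less_iff:
  assumes "b < M" "b' < M"
  shows "pair_rank M (a, b) < pair_rank M (a', b') \<longleftrightarrow>
    a < a' \<or> a = a' \<and> (if even a then b' < b else b < b')"
  using pair_rank_less[OF assms, of a a'] pair_rank_less[OF assms(2,1), of a' a] assms
  by (cases a a' rule: linorder_cases) (auto simp: pair_rank_def)

lemma inj_on_pair_rank: "inj_on (pair_rank M) (A \<times> {..<M})"
proof (rule inj_onI, clarify)
  fix a b a' b' assume "b < M" "b' < M" and eq: "pair_rank M (a, b) = pair_rank M (a', b')"
  then have "\<not> (a < a' \<or> a = a' \<and> (if even a then b' < b else b < b'))"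
    "\<not> (a' < a \<or> a' = a \<and> (if even a' then b < b' else b' < b))"
    using pair_rank_less_iff[of b M b' a a'] pair_rank_less_iff[of b' M b a' a] by auto
  then show "a = a' \<and> b = b'" by (auto split: if_splits)
qed

lemma letter_sum_cong:
  "(\<And>k. k \<in> {1..<n} \<Longrightarrow> d k = d' k) \<Longrightarrow> letter_sum y n d i = letter_sum y n d' i"
  unfolding letter_sum_def path_sum_def
  by (subst paths_cong[of n "letter_step d" "letter_step d'"]) (auto simp: letter_step_def fun_eq_iff)

text \<open>The biword with columns \<open>(f k, g (\<pi> k))\<close> encodes a multiset of pairs of letters in which only
  pairs of letters of equal parity may be repeated.\<close>

theorem sum_letter_sum_inverse:
  fixes y z :: "'a::comm_ring_1"
  shows "Abs_fps (\<lambda>n. \<Sum>\<pi> | \<pi> permutes {1..n}.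
        letter_sum y n (descends \<pi>) i * letter_sum z n (descends (inv \<pi>)) j) *
      ((1 - fps_const (y * z) * fps_X) * (1 - fps_X)) ^ (i * j) =
    ((1 + fps_const y * fps_X) * (1 + fps_const z * fps_X)) ^ (i * j)"
proof -
  let ?S = "{..<2 * i} \<times> {..<2 * j}"
  let ?w = "\<lambda>(a, b). letter_weight y a * letter_weight z b"
  let ?rep = "\<lambda>(a, b). even (a::nat) \<longleftrightarrow> even (b::nat)"
  have sum: "(\<Sum>\<pi> | \<pi> permutes {1..n}.
        letter_sum y n (descends \<pi>) i * letter_sum z n (descends (inv \<pi>)) j) =
      path_sum ?S pair_step ?w n" for n
  proof -
    have "(\<Sum>\<pi> | \<pi> permutes {1..n}. letter_sum y n (descends \<pi>) i *
          path_sum {..<2 * j} (letter_step (descends (inv \<pi>))) (letter_weight z) n) =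
        (\<Sum>b\<in>{1..n} \<rightarrow>\<^sub>E {..<2 * j}. letter_sum y n (\<lambda>k. prec b (Suc k) k) i *
          (\<Prod>k=1..n. letter_weight z (b k)))"
      by (rule sum_permutations_standardization[where H = "\<lambda>d. letter_sum y n d i"])
        (auto intro: letter_sum_cong)
    then show ?thesis
      unfolding letter_sum_def by (simp only: sum_words_eq_path_sum_pairs finite_lessThan)
  qed
  have gf: "Abs_fps (path_sum ?S pair_step ?w) *
      (\<Prod>c\<in>?S. if ?rep c then 1 - fps_const (?w c) * fps_X else 1) =
      (\<Prod>c\<in>?S. if ?rep c then 1 else 1 + fps_const (?w c) * fps_X)"
  proof (rule path_sum_rank_order[where rk = "pair_rank (2 * j)"])
    fix k c c' assume "c \<in> ?S" "c' \<in> ?S"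
    then show "pair_step k c c' \<longleftrightarrow> pair_rank (2 * j) c < pair_rank (2 * j) c' \<or> c = c' \<and> ?rep c"
      by (auto simp: pair_step_def letter_step_def pair_rank_less_iff split: if_splits)
  qed (auto intro: inj_on_pair_rank)
  \<comment> \<open>The factor of a pair depends only on the two parities: the \<open>i * j\<close>
    pairs of each equal-parity type, with weights \<open>y * z\<close> and 1, give the denominator;
    the mixed ones, with weights \<open>y\<close> and \<open>z\<close>, give the numerator.\<close>
  define f where "f p q = (if p = q
    then 1 - fps_const ((if p then y else 1) * (if q then z else 1)) * fps_X else 1)" for p q
  define g where "g p q = (if p = q
    then 1 else 1 + fps_const ((if p then y else 1) * (if q then z else 1)) * fps_X)" for p q
  have "(\<Prod>c\<in>?S. if ?rep c then 1 - fps_const (?w c) * fps_X else 1) =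
      (\<Prod>(a, b)\<in>?S. f (even a) (even b))"
    by (intro prod.cong refl) (auto simp: letter_weight_def f_def split: if_splits)
  also have "\<dots> = ((1 - fps_const (y * z) * fps_X) * (1 - fps_X)) ^ (i * j)"
    unfolding prod_parity_pairs by (simp add: f_def)
  finally have den: "(\<Prod>c\<in>?S. if ?rep c then 1 - fps_const (?w c) * fps_X else 1) =
      ((1 - fps_const (y * z) * fps_X) * (1 - fps_X)) ^ (i * j)" .
  have "(\<Prod>c\<in>?S. if ?rep c then 1 else 1 + fps_const (?w c) * fps_X) =
      (\<Prod>(a, b)\<in>?S. g (even a) (even b))"
    by (intro prod.cong refl) (auto simp: letter_weight_def g_def split: if_splits)
  also have "\<dots> = ((1 + fps_const y * fps_X) * (1 + fps_const z * fps_X)) ^ (i * j)"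
    unfolding prod_parity_pairs by (simp add: g_def)
  finally have num: "(\<Prod>c\<in>?S. if ?rep c then 1 else 1 + fps_const (?w c) * fps_X) =
      ((1 + fps_const y * fps_X) * (1 + fps_const z * fps_X)) ^ (i * j)" .
  show ?thesis using gf unfolding den num sum .
qed

section \<open>Eulerian polynomials from the case of weight zero\<close>

lemma sum_prod_words:
  fixes w :: "'c \<Rightarrow> 'a::comm_semiring_1"
  assumes "finite S"
  shows "(\<Sum>b\<in>{1..n::nat} \<rightarrow>\<^sub>E S. \<Prod>k=1..n. w (b k)) = (\<Sum>c\<in>S. w c) ^ n"
  using prod_sum_PiE[of "{1..n}" "\<lambda>_. S" "\<lambda>_. w"] assms by simp

text \<open>At weight 0 only words in the \<open>i\<close> unprimed letters survive, and
  standardization with \<open>H\<close> constant runs through all of them.\<close>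

lemma sum_letter_sum_0:
  "(\<Sum>\<pi> | \<pi> permutes {1..n}. letter_sum 0 n (descends \<pi>) i) = (of_nat i ^ n :: 'a::comm_semiring_1)"
proof -
  have "(\<Sum>\<pi> | \<pi> permutes {1..n}. letter_sum (0::'a) n (descends \<pi>) i) =
      (\<Sum>\<pi> | \<pi> permutes {1..n}. letter_sum 0 n (descends (inv \<pi>)) i)"
    by (rule sum_permutations_inverse)
  also have "\<dots> = (\<Sum>\<pi> | \<pi> permutes {1..n}. 1 * letter_sum 0 n (descends (inv \<pi>)) i)"
    by simp
  also have "\<dots> = (\<Sum>b\<in>{1..n} \<rightarrow>\<^sub>E {..<2 * i}. 1 * (\<Prod>k=1..n. letter_weight 0 (b k)))"
    unfolding letter_sum_def by (rule sum_permutations_standardization) auto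
  also have "\<dots> = (\<Sum>c<2 * i. letter_weight 0 c) ^ n"
    by (simp only: sum_prod_words finite_lessThan mult_1_left)
  also have "(\<Sum>c<2 * i. letter_weight (0::'a) c) = of_nat i"
    by (simp add: sum_lessThan_double letter_weight_def)
  finally show ?thesis .
qed

text \<open>At \<open>y = 0\<close> the closed form for one permutation reduces to a power of
  \<open>fps_X\<close> with exponent \<open>des n \<pi> + 1\<close>, after cancelling the peak
  power. For \<open>n = 0\<close> the series is geometric, with \<open>0 ^ 0 = 1\<close>.\<close>

lemma eulerian_poly_gf:
  "(1 - fps_X) ^ (n + 1) * Abs_fps (\<lambda>i. of_nat i ^ n) = (eulerian_poly n fps_X :: 'a::idom fps)"
proof (cases "n = 0")
  case True
  then show ?thesis
    by (auto simp: eulerian_poly_def fps_eq_iff left_diff_distrib fps_X_mult_nth)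
next
  case False
  have "(1 - fps_X) ^ (n + 1) * Abs_fps (letter_sum (0::'a) n (descends \<pi>)) = fps_X ^ (des n \<pi> + 1)"
    if "\<pi> permutes {1..n}" for \<pi>
  proof -
    have "(1 - fps_X) ^ (n + 1) * Abs_fps (letter_sum (0::'a) n (descends \<pi>)) * fps_X ^ pk n \<pi> =
        fps_X ^ (pk n \<pi> + 1) * fps_X ^ des n \<pi>"
      using letter_sum_gf_permutation[of n \<pi> "0::'a"] False permutes_inj[OF that] by simp
    then have "((1 - fps_X) ^ (n + 1) * Abs_fps (letter_sum (0::'a) n (descends \<pi>))) * fps_X ^ pk n \<pi> =
        fps_X ^ (des n \<pi> + 1) * fps_X ^ pk n \<pi>"
      by (simp add: mult_ac)
    then show ?thesis by simp
  qed
  then have "(1 - fps_X) ^ (n + 1) * (\<Sum>\<pi> | \<pi> permutes {1..n}. Abs_fps (letter_sum (0::'a) n (descends \<pi>))) =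
      eulerian_poly n fps_X"
    using False by (simp add: eulerian_poly_def sum_distrib_left)
  moreover have "(\<Sum>\<pi> | \<pi> permutes {1..n}. Abs_fps (letter_sum (0::'a) n (descends \<pi>))) =
      Abs_fps (\<lambda>i. of_nat i ^ n)"
    by (simp only: fps_eq_iff fps_sum_nth sum_letter_sum_0 fps_nth_Abs_fps) simp
  ultimately show ?thesis by simp
qed

section \<open>Power sum expansion\<close>

lemma zee_add_mset: "zee (add_mset k \<nu>) = k * Suc (count \<nu> k) * zee \<nu>"
proof -
  let ?f = "\<lambda>\<mu> i. (i::nat) ^ count \<mu> i * fact (count \<mu> i) :: nat"
  have rest: "(\<Prod>i\<in>set_mset \<nu> - {k}. ?f (add_mset k \<nu>) i) = (\<Prod>i\<in>set_mset \<nu> - {k}. ?f \<nu> i)"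
    by (intro prod.cong) auto
  have "zee (add_mset k \<nu>) = ?f (add_mset k \<nu>) k * (\<Prod>i\<in>set_mset \<nu> - {k}. ?f \<nu> i)"
    unfolding zee_def set_mset_add_mset_insert rest[symmetric]
    by (subst prod.insert_remove) simp_all
  also have "?f (add_mset k \<nu>) k = k * Suc (count \<nu> k) * ?f \<nu> k" by (simp add: algebra_simps)
  also have "\<dots> * (\<Prod>i\<in>set_mset \<nu> - {k}. ?f \<nu> i) = k * Suc (count \<nu> k) * zee \<nu>"
  proof (cases "k \<in># \<nu>")
    case True
    then show ?thesis by (simp add: zee_def prod.remove[of "set_mset \<nu>" k] mult.assoc)
  next
    case False
    then have "count \<nu> k = 0" "set_mset \<nu> - {k} = set_mset \<nu>" by (auto simp: not_in_iff)
    then show ?thesis by (simp add: zee_def)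
  qed
  finally show ?thesis .
qed

lemma sum_mset_eq_sum_count:
  fixes \<mu> :: "nat multiset"
  shows "\<Sum>\<^sub># \<mu> = (\<Sum>k\<in>set_mset \<mu>. k * count \<mu> k)"
proof -
  \<comment> \<open>A fixed superset \<open>S\<close> spares the induction a changing index
    set.\<close>
  have "\<Sum>\<^sub># \<mu> = (\<Sum>k\<in>S. k * count \<mu> k)" if "finite S" "set_mset \<mu> \<subseteq> S" for S
    using that
  proof (induction \<mu>)
    case (add x \<mu>)
    have "(\<Sum>k\<in>S. k * count (add_mset x \<mu>) k) = (\<Sum>k\<in>S. k * count \<mu> k + (if k = x then x else 0))"
      by (intro sum.cong) auto
    then show ?case using add by (simp add: sum.distrib)
  qed simp
  then show ?thesis by blast
qed

lemma zee_pos: "0 \<notin># \<mu> \<Longrightarrow> zee \<mu> > 0"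
  unfolding zee_def by (intro prod_pos) (auto intro: gr0I)

text \<open>The complete homogeneous symmetric function in terms of power sums \<open>p\<close>. The
  reciprocals of positive integers enter as a function \<open>q\<close>, since the coefficient ring
  need not be a field.\<close>

definition partition_sum :: "(nat \<Rightarrow> 'a) \<Rightarrow> (nat \<Rightarrow> 'a) \<Rightarrow> nat \<Rightarrow> 'a::comm_ring_1" where
  "partition_sum p q n = (\<Sum>\<mu>\<in>partitions n. q (zee \<mu>) * (\<Prod>k\<in>#\<mu>. p k))"

context
  fixes p q :: "nat \<Rightarrow> 'a::comm_ring_1"
  assumes q: "\<And>k. k > 0 \<Longrightarrow> of_nat k * q k = 1"
begin

lemma of_nat_mult_reciprocal:
  assumes "a > 0" "b > 0"
  shows "of_nat a * q (a * b) = q b"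
proof -
  have "of_nat a * q (a * b) = (of_nat b * q b) * (of_nat a * q (a * b))" using q[OF assms(2)] by simp
  also have "\<dots> = q b * (of_nat (a * b) * q (a * b))" by (simp add: mult_ac)
  also have "\<dots> = q b" using q[of "a * b"] assms by simp
  finally show ?thesis .
qed

text \<open>Newton's identity: write \<open>n\<close> as the sum of the parts of \<open>\<mu>\<close> and remove one part \<open>k\<close>.\<close>

lemma partition_sum_rec: "of_nat n * partition_sum p q n = (\<Sum>k=1..n. p k * partition_sum p q (n - k))"
proof -
  have "of_nat n * partition_sum p q n =
      (\<Sum>\<mu>\<in>partitions n. \<Sum>k\<in>set_mset \<mu>. of_nat (k * count \<mu> k) * (q (zee \<mu>) * (\<Prod>k\<in>#\<mu>. p k)))"
    unfolding partition_sum_def sum_distrib_left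
  proof (intro sum.cong refl)
    fix \<mu> assume "\<mu> \<in> partitions n"
    then have n: "(\<Sum>k\<in>set_mset \<mu>. k * count \<mu> k) = n"
      using sum_mset_eq_sum_count[of \<mu>] by (simp add: partitions_def)
    have "of_nat n = (\<Sum>k\<in>set_mset \<mu>. of_nat (k * count \<mu> k) :: 'a)"
      unfolding n[symmetric] by (rule of_nat_sum)
    then show "of_nat n * (q (zee \<mu>) * (\<Prod>k\<in>#\<mu>. p k)) =
        (\<Sum>k\<in>set_mset \<mu>. of_nat (k * count \<mu> k) * (q (zee \<mu>) * (\<Prod>k\<in>#\<mu>. p k)))"
      by (simp only: sum_distrib_right)
  qed
  also have "\<dots> = (\<Sum>(\<mu>, k)\<in>(SIGMA \<mu>:partitions n. set_mset \<mu>).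
      of_nat (k * count \<mu> k) * (q (zee \<mu>) * (\<Prod>k\<in>#\<mu>. p k)))"
    by (rule sum.Sigma) (auto simp: finite_partitions)
  also have "\<dots> = (\<Sum>(k, \<nu>)\<in>(SIGMA k:{1..n}. partitions (n - k)). p k * (q (zee \<nu>) * (\<Prod>k\<in>#\<nu>. p k)))"
  proof (rule sum.reindex_bij_witness[of _ "\<lambda>(k, \<nu>). (add_mset k \<nu>, k)" "\<lambda>(\<mu>, k). (k, \<mu> - {#k#})"],
      goal_cases)
    case (2 x)
    then obtain \<mu> k where x: "x = (\<mu>, k)" "\<mu> \<in> partitions n" "k \<in># \<mu>" by auto
    then obtain \<nu> where \<nu>: "\<mu> = add_mset k \<nu>" by (metis mset_add)
    then show ?case using x by (auto simp: partitions_def)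
  next
    case (5 x)
    then obtain \<mu> k where x: "x = (\<mu>, k)" "\<mu> \<in> partitions n" "k \<in># \<mu>" by auto
    then obtain \<nu> where \<nu>: "\<mu> = add_mset k \<nu>" by (metis mset_add)
    have pos: "k > 0" "0 \<notin># \<nu>" using x \<nu> by (auto simp: partitions_def intro: gr0I)
    \<comment> \<open>The weight \<open>k\<close> times the multiplicity of \<open>k\<close> in
      \<open>\<mu>\<close> is the factor by which \<open>zee \<mu>\<close> exceeds
      \<open>zee \<nu>\<close>.\<close>
    have red: "of_nat (k * Suc (count \<nu> k)) * q (zee \<mu>) = q (zee \<nu>)"
      unfolding \<nu> zee_add_mset using pos zee_pos by (intro of_nat_mult_reciprocal) auto
    have "of_nat (k * count \<mu> k) * (q (zee \<mu>) * (\<Prod>k\<in>#\<mu>. p k)) =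
        (of_nat (k * Suc (count \<nu> k)) * q (zee \<mu>)) * (p k * (\<Prod>k\<in>#\<nu>. p k))"
      by (simp only: \<nu> count_add_mset if_True image_mset_add_mset prod_mset.add_mset mult.assoc refl)
    also have "\<dots> = p k * (q (zee \<nu>) * (\<Prod>k\<in>#\<nu>. p k))"
      unfolding red by (simp only: mult_ac)
    also have "\<nu> = \<mu> - {#k#}" using \<nu> by simp
    finally show ?case unfolding x(1) prod.case by (rule sym)
  qed (auto simp: partitions_def)
  also have "\<dots> = (\<Sum>k=1..n. \<Sum>\<nu>\<in>partitions (n - k). p k * (q (zee \<nu>) * (\<Prod>k\<in>#\<nu>. p k)))"
    by (rule sum.Sigma[symmetric]) (auto simp: finite_partitions)
  finally show ?thesis by (simp add: partition_sum_def sum_distrib_left)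
qed

lemma partition_sum_0: "partition_sum p q 0 = 1"
proof -
  have "partitions 0 = {{#}}" by (auto simp: partitions_def) (metis multiset_nonemptyE)
  then show ?thesis using q[of 1] by (simp add: partition_sum_def zee_def)
qed

text \<open>Newton's recursion and the value at 0 determine a sequence, because positive integers
  are invertible.\<close>

lemma eq_partition_sum:
  assumes "h 0 = 1" and rec: "\<And>n. of_nat n * h n = (\<Sum>k=1..n. p k * h (n - k))"
  shows "h n = partition_sum p q n"
proof (induction n rule: less_induct)
  case (less n)
  show ?case
  proof (cases "n = 0")
    case False
    have "(\<Sum>k=1..n. p k * h (n - k)) = (\<Sum>k=1..n. p k * partition_sum p q (n - k))"
      using less by (intro sum.cong) auto
    then have "of_nat n * h n = of_nat n * partition_sum p q n" by (simp only: rec partition_sum_rec)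
    then have "(of_nat n * q n) * h n = (of_nat n * q n) * partition_sum p q n"
      by (simp only: mult.commute[of "of_nat n" "q n"] mult.assoc)
    then show ?thesis using q[of n] False by simp
  qed (use assms partition_sum_0 in simp)
qed

end

section \<open>Logarithmic derivatives x f' / f, stated without division\<close>

definition log_deriv :: "'a::comm_ring_1 fps \<Rightarrow> 'a fps \<Rightarrow> bool" where
  "log_deriv f g \<longleftrightarrow> fps_X * fps_deriv f = f * g"

text \<open>The expansion of a x / (1 - a x), the negative of the logarithmic derivative of 1 - a
  x.\<close>

definition geo_tail :: "'a \<Rightarrow> 'a::comm_ring_1 fps" where
  "geo_tail a = Abs_fps (\<lambda>k. if k = 0 then 0 else a ^ k)"

lemma log_deriv_one_minus: "log_deriv (1 - fps_const a * fps_X) (- geo_tail a)"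
proof -
  have "(1 - fps_const a * fps_X) * geo_tail a = fps_const a * fps_X"
  proof (rule fps_ext)
    fix n
    show "fps_nth ((1 - fps_const a * fps_X) * geo_tail a) n = fps_nth (fps_const a * fps_X) n"
      by (cases n) (auto simp: geo_tail_def left_diff_distrib mult.assoc)
  qed
  then show ?thesis by (simp add: log_deriv_def mult.commute flip: fps_const_neg)
qed

lemma log_deriv_mult:
  "log_deriv f u \<Longrightarrow> log_deriv g v \<Longrightarrow> log_deriv (f * g) (u + v)"
proof -
  assume "log_deriv f u" "log_deriv g v"
  then have f: "fps_X * fps_deriv f = f * u" and g: "fps_X * fps_deriv g = g * v"
    by (simp_all add: log_deriv_def)
  have "fps_X * fps_deriv (f * g) = f * (fps_X * fps_deriv g) + g * (fps_X * fps_deriv f)"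
    by (simp add: algebra_simps)
  then show ?thesis unfolding log_deriv_def f g by (simp add: algebra_simps)
qed

lemma log_deriv_power: "log_deriv f u \<Longrightarrow> log_deriv (f ^ m) (of_nat m * u)"
proof (induction m)
  case (Suc m)
  then show ?case using log_deriv_mult[of f u "f ^ m" "of_nat m * u"] by (simp add: algebra_simps)
qed (simp add: log_deriv_def)

text \<open>Needed because \<open>base_series\<close> is accessible only through its product with
  the denominator.\<close>

lemma log_deriv_cancel:
  fixes b f :: "'a::idom fps"
  assumes "log_deriv (b * f) u" "log_deriv f v" "f \<noteq> 0"
  shows "log_deriv b (u - v)"
proof -
  have f: "fps_X * fps_deriv f = f * v" and bf: "fps_X * fps_deriv (b * f) = b * f * u"
    using assms by (simp_all add: log_deriv_def)
  have "f * (fps_X * fps_deriv b) = fps_X * fps_deriv (b * f) - b * (fps_X * fps_deriv f)"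
    by (simp add: algebra_simps)
  also have "\<dots> = f * (b * (u - v))" unfolding f bf by (simp add: algebra_simps)
  finally show ?thesis using assms(3) by (simp add: log_deriv_def)
qed

text \<open>Comparing coefficients gives a recursion of the shape required by
  \<open>eq_partition_sum\<close>.\<close>

lemma log_deriv_nth:
  assumes "log_deriv f u" "fps_nth u 0 = 0"
  shows "of_nat n * fps_nth f n = (\<Sum>k=1..n. fps_nth u k * fps_nth f (n - k))"
proof -
  have "of_nat n * fps_nth f n = fps_nth (fps_X * fps_deriv f) n"
    by (cases n) auto
  also have "\<dots> = fps_nth (u * f) n" using assms(1) by (simp add: log_deriv_def mult.commute)
  also have "\<dots> = (\<Sum>k=0..n. fps_nth u k * fps_nth f (n - k))" by (simp add: fps_mult_nth)
  also have "\<dots> = (\<Sum>k=1..n. fps_nth u k * fps_nth f (n - k))"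
    using assms(2) by (simp add: sum.atLeast_Suc_atMost)
  finally show ?thesis .
qed

text \<open>The four linear factors of the base series combine into the product that each part
  contributes in (b). The coefficient at 0 vanishes on both sides.\<close>

lemma geo_tail_combination:
  "- geo_tail (- a) + - geo_tail (- b) - (- geo_tail (a * b) + - geo_tail 1) =
    Abs_fps (\<lambda>k. (1 - (- a) ^ k) * (1 - (- b) ^ k))"
proof (rule fps_ext)
  fix k
  have "(a * b) ^ k = (- a) ^ k * (- b) ^ k" by (simp flip: power_mult_distrib)
  then show "fps_nth (- geo_tail (- a) + - geo_tail (- b) - (- geo_tail (a * b) + - geo_tail 1)) k =
      fps_nth (Abs_fps (\<lambda>k. (1 - (- a) ^ k) * (1 - (- b) ^ k))) k"
    by (simp add: geo_tail_def algebra_simps)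
qed

abbreviation ry :: "rat fps fps" where "ry \<equiv> fps_const fps_X"
abbreviation rz :: "rat fps fps" where "rz \<equiv> fps_X"

definition rat_reciprocal :: "nat \<Rightarrow> rat fps fps" where
  "rat_reciprocal k = fps_const (fps_const (1 / of_nat k))"

lemma rat_reciprocal: "k > 0 \<Longrightarrow> of_nat k * rat_reciprocal k = 1"
  by (simp add: rat_reciprocal_def fps_of_nat[symmetric])

lemma log_deriv_base_series:
  "log_deriv base_series (Abs_fps (\<lambda>k. (1 - (- ry) ^ k) * (1 - (- rz) ^ k)))"
proof -
  let ?den = "(1 - fps_const (ry * rz) * fps_X) * (1 - fps_const 1 * fps_X)"
  have "log_deriv ((1 - fps_const (- ry) * fps_X) * (1 - fps_const (- rz) * fps_X))
      (- geo_tail (- ry) + - geo_tail (- rz))"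
    by (intro log_deriv_mult log_deriv_one_minus)
  moreover have "(1 - fps_const (- ry) * fps_X) * (1 - fps_const (- rz) * fps_X) = base_series * ?den"
    using base_series_mult by (simp flip: fps_const_neg fps_const_mult)
  ultimately have num: "log_deriv (base_series * ?den) (- geo_tail (- ry) + - geo_tail (- rz))"
    by simp
  have den: "log_deriv ?den (- geo_tail (ry * rz) + - geo_tail 1)"
    by (intro log_deriv_mult log_deriv_one_minus)
  have "fps_nth ?den 0 \<noteq> 0" by simp
  then have "?den \<noteq> 0" by (metis fps_zero_nth)
  from log_deriv_cancel[OF num den this]
  have "log_deriv base_series (- geo_tail (- ry) + - geo_tail (- rz) - (- geo_tail (ry * rz) + - geo_tail 1))" .
  moreover have "- geo_tail (- ry) + - geo_tail (- rz) - (- geo_tail (ry * rz) + - geo_tail 1) =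
      Abs_fps (\<lambda>k. (1 - (- ry) ^ k) * (1 - (- rz) ^ k))"
    by (rule geo_tail_combination)
  ultimately show ?thesis by simp
qed

lemma base_series_nth_0: "fps_nth base_series 0 = 1"
  using arg_cong[OF base_series_mult, of "\<lambda>f. fps_nth f 0"] by simp

text \<open>Taking the \<open>m\<close>-th power multiplies the logarithmic derivative by
  \<open>m\<close>, so every part of the partition contributes a factor \<open>m\<close>.\<close>

lemma base_series_power_nth:
  "fps_nth (base_series ^ m) n =
    (\<Sum>\<mu>\<in>partitions n. rat_reciprocal (zee \<mu>) * (\<Prod>k\<in>#\<mu>. (1 - (- ry) ^ k) * (1 - (- rz) ^ k)) * of_nat m ^ size \<mu>)"
proof -
  let ?p = "\<lambda>k. (1 - (- ry) ^ k) * (1 - (- rz) ^ k)"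
  have "of_nat n * fps_nth (base_series ^ m) n =
      (\<Sum>k=1..n. of_nat m * ?p k * fps_nth (base_series ^ m) (n - k))" for n
    using log_deriv_nth[OF log_deriv_power[OF log_deriv_base_series, of m], of n]
    by (simp flip: fps_of_nat)
  then have "fps_nth (base_series ^ m) n = partition_sum (\<lambda>k. of_nat m * ?p k) rat_reciprocal n"
    by (intro eq_partition_sum rat_reciprocal) (simp_all add: base_series_nth_0 fps_nth_power_0)
  also have "\<dots> = (\<Sum>\<mu>\<in>partitions n. rat_reciprocal (zee \<mu>) * (\<Prod>k\<in>#\<mu>. ?p k) * of_nat m ^ size \<mu>)"
    unfolding partition_sum_def
    by (intro sum.cong refl) (simp add: prod_mset.distrib mult_ac)
  finally show ?thesis .
qed

section \<open>Passage to the fraction field\<close>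

text \<open>Dividing out the product identity shows the origin of the substitution: every peak
  contributes \<open>(1 + y)\<^sup>2 * s / ((y + s) * (1 + y * s))\<close> and every descent
  \<open>(y + s) / (1 + y * s)\<close>.\<close>

lemma peak_descent_monomial:
  fixes y s G :: "'a::field"
  assumes eq: "(1 - s) ^ (n + 1) * G * (1 + y * s) ^ (D + P + 1) * (y + s) ^ P =
      (1 + y) ^ (2 * P + 1) * s ^ (P + 1) * (1 + y * s) ^ n * (y + s) ^ D"
    and nz: "1 - s \<noteq> 0" "1 + y * s \<noteq> 0" "y + s \<noteq> 0" "1 + y \<noteq> 0"
  shows "((1 + y * s) / (1 - s)) ^ (n + 1) * ((1 + y)\<^sup>2 * s / ((y + s) * (1 + y * s))) ^ (P + 1) *
      ((y + s) / (1 + y * s)) ^ (D + 1) / (1 + y) = G"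
proof -
  define a b c e where defs: "a = 1 - s" "b = 1 + y * s" "c = y + s" "e = 1 + y"
  have nz': "a \<noteq> 0" "b \<noteq> 0" "c \<noteq> 0" "e \<noteq> 0" using nz by (simp_all add: defs)
  have eq': "a ^ (n + 1) * G * b ^ (D + P + 1) * c ^ P = e ^ (2 * P + 1) * s ^ (P + 1) * b ^ n * c ^ D"
    using eq by (simp add: defs)
  have "(b / a) ^ (n + 1) * (e\<^sup>2 * s / (c * b)) ^ (P + 1) * (c / b) ^ (D + 1) / e =
      (e ^ (2 * P + 1) * s ^ (P + 1) * b ^ n * c ^ D) / (a ^ (n + 1) * b ^ (D + P + 1) * c ^ P)"
    using nz' by (simp add: field_simps power_add power_mult power_mult_distrib power2_eq_square)
  also have "\<dots> = G" unfolding eq'[symmetric] using nz' by simp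
  finally show ?thesis by (simp add: defs)
qed

text \<open>An embedding of a power series ring into a field. It is interpreted twice, for the outer
  variable t and, through constants, for s, so that both halves of the argument are carried out
  once.\<close>

locale fps_hom =
  fixes \<phi> :: "'r::idom fps \<Rightarrow> 'f::field"
  assumes \<phi>_1: "\<phi> 1 = 1" and \<phi>_0: "\<phi> 0 = 0"
    and \<phi>_add: "\<phi> (a + b) = \<phi> a + \<phi> b" and \<phi>_diff: "\<phi> (a - b) = \<phi> a - \<phi> b"
    and \<phi>_mult: "\<phi> (a * b) = \<phi> a * \<phi> b" and \<phi>_eq_0: "\<phi> a = 0 \<longleftrightarrow> a = 0"
begin

lemma \<phi>_power: "\<phi> (a ^ k) = \<phi> a ^ k"
  by (induction k) (simp_all add: \<phi>_1 \<phi>_mult)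

lemma \<phi>_sum: "\<phi> (sum f A) = (\<Sum>x\<in>A. \<phi> (f x))"
  by (induction A rule: infinite_finite_induct) (simp_all add: \<phi>_0 \<phi>_add)

lemma one_minus_X_nonzero: "1 - \<phi> fps_X \<noteq> 0"
proof -
  have "fps_nth (1 - fps_X :: 'r fps) 0 = 1" by simp
  then have "(1 - fps_X :: 'r fps) \<noteq> 0" by (metis fps_zero_nth zero_neq_one)
  then show ?thesis using \<phi>_eq_0[of "1 - fps_X"] by (simp add: \<phi>_diff \<phi>_1)
qed

lemma \<phi>_eulerian_poly: "\<phi> (eulerian_poly n x) = eulerian_poly n (\<phi> x)"
  by (simp only: eulerian_poly_def if_distrib[of \<phi>] \<phi>_1 \<phi>_sum \<phi>_power)

lemma \<phi>_powers_gf: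
  "\<phi> (Abs_fps (\<lambda>i. of_nat i ^ n)) = eulerian_poly n (\<phi> fps_X) / (1 - \<phi> fps_X) ^ (n + 1)"
proof -
  have "(1 - \<phi> fps_X) ^ (n + 1) * \<phi> (Abs_fps (\<lambda>i. of_nat i ^ n)) = eulerian_poly n (\<phi> fps_X)"
    using arg_cong[OF eulerian_poly_gf[of n], of \<phi>]
    by (simp only: \<phi>_mult \<phi>_power \<phi>_diff \<phi>_1 \<phi>_eulerian_poly)
  then show ?thesis using one_minus_X_nonzero by (simp add: field_simps)
qed

lemma \<phi>_letter_sum:
  assumes "n > 0" "\<pi> permutes {1..n}" "1 + y \<noteq> 0"
  defines "Y \<equiv> \<phi> (fps_const y)" and "S \<equiv> \<phi> fps_X"
  shows "((1 + Y * S) / (1 - S)) ^ (n + 1) * ((1 + Y)\<^sup>2 * S / ((Y + S) * (1 + Y * S))) ^ (pk n \<pi> + 1) *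
      ((Y + S) / (1 + Y * S)) ^ (des n \<pi> + 1) / (1 + Y) = \<phi> (Abs_fps (letter_sum y n (descends \<pi>)))"
proof (rule peak_descent_monomial)
  show "(1 - S) ^ (n + 1) * \<phi> (Abs_fps (letter_sum y n (descends \<pi>))) *
      (1 + Y * S) ^ (des n \<pi> + pk n \<pi> + 1) * (Y + S) ^ pk n \<pi> =
      (1 + Y) ^ (2 * pk n \<pi> + 1) * S ^ (pk n \<pi> + 1) * (1 + Y * S) ^ n * (Y + S) ^ des n \<pi>"
    using arg_cong[OF letter_sum_gf_permutation[OF assms(1) permutes_inj[OF assms(2)], of y], of \<phi>]
    by (simp only: \<phi>_mult \<phi>_power \<phi>_diff \<phi>_1 \<phi>_add Y_def S_def)
  have nz: "\<phi> a \<noteq> 0" if "fps_nth a k \<noteq> 0" for a k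
    using that \<phi>_eq_0[of a] by auto
  show "1 - S \<noteq> 0" using one_minus_X_nonzero by (simp add: S_def)
  show "1 + Y * S \<noteq> 0" using nz[of "1 + fps_const y * fps_X" 0]
    by (simp add: Y_def S_def \<phi>_add \<phi>_mult \<phi>_1)
  \<comment> \<open>The constant term \<open>y\<close> might vanish, but the coefficient of
    \<open>fps_X\<close> is 1.\<close>
  show "Y + S \<noteq> 0" using nz[of "fps_const y + fps_X" 1]
    by (simp add: Y_def S_def \<phi>_add)
  show "1 + Y \<noteq> 0" using nz[of "1 + fps_const y" 0] assms(3)
    by (simp add: Y_def \<phi>_add \<phi>_1)
qed

end

interpretation outer: fps_hom "to_fract :: 'r::idom fps \<Rightarrow> 'r fps fract"
  by standard simp_all

interpretation inner: fps_hom "\<lambda>f :: 'r::idom fps. to_fract (fps_const f) :: 'r fps fps fract"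
  by standard (simp_all flip: fps_const_add fps_const_sub fps_const_mult to_fract_add to_fract_diff to_fract_mult)

lemma fps_const_sum: "fps_const (sum f A) = (\<Sum>x\<in>A. fps_const (f x))"
  by (induction A rule: infinite_finite_induct) (simp_all flip: fps_const_add)

lemma fps_const_prod: "fps_const (prod f A) = (\<Prod>x\<in>A. fps_const (f x :: 'a::comm_ring_1))"
  by (induction A rule: infinite_finite_induct) (simp_all flip: fps_const_mult)

lemma letter_sum_fps_const:
  "letter_sum (fps_const z) n d j = fps_const (letter_sum (z :: 'a::comm_ring_1) n d j)"
proof -
  have "letter_weight (fps_const z) c = fps_const (letter_weight z c)" for c
    by (simp add: letter_weight_def)
  then show ?thesis by (simp add: letter_sum_def path_sum_def fps_const_sum fps_const_prod)
qed

text \<open>Both series give the same numerator when multiplied by the same power of the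
  denominator, which is nonzero and can be cancelled.\<close>

lemma base_series_power_nth_eq_letter_sums:
  "fps_nth (base_series ^ (i * j)) n = (\<Sum>\<pi> | \<pi> permutes {1..n}.
     letter_sum ry n (descends \<pi>) i * letter_sum rz n (descends (inv \<pi>)) j)"
proof -
  let ?den = "(1 - fps_const (ry * rz) * fps_X) * (1 - fps_X)"
  let ?G = "Abs_fps (\<lambda>n. \<Sum>\<pi> | \<pi> permutes {1..n}.
     letter_sum ry n (descends \<pi>) i * letter_sum rz n (descends (inv \<pi>)) j)"
  have "base_series * ?den = (1 + fps_const ry * fps_X) * (1 + fps_const rz * fps_X)"
    using base_series_mult by (simp flip: fps_const_mult)
  then have "base_series ^ (i * j) * ?den ^ (i * j) =
      ((1 + fps_const ry * fps_X) * (1 + fps_const rz * fps_X)) ^ (i * j)"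
    by (simp only: power_mult_distrib[symmetric])
  then have eq: "base_series ^ (i * j) * ?den ^ (i * j) = ?G * ?den ^ (i * j)"
    by (simp only: sum_letter_sum_inverse)
  have "fps_nth ?den 0 \<noteq> 0" by simp
  then have "?den \<noteq> 0" by (metis fps_zero_nth)
  then have "?den ^ (i * j) \<noteq> 0" by (rule power_not_zero)
  from mult_right_cancel[OF this] eq have "base_series ^ (i * j) = ?G" by (rule iffD1)
  then show ?thesis by simp
qed

section \<open>Coefficients of x^n as series in s and t\<close>

abbreviation st_coeff :: "nat \<Rightarrow> rat fps fps fps fps" where
  "st_coeff n \<equiv> Abs_fps (\<lambda>j. Abs_fps (\<lambda>i. fps_nth (base_series ^ (i * j)) n))"

text \<open>In the iterated ring the factor in y and s is constant in t, while the factor in z and t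
  has coefficients constant in s; hence the two uses of \<open>fps_const\<close>.\<close>

lemma st_coeff_eq_letter_sums:
  "st_coeff n = (\<Sum>\<pi> | \<pi> permutes {1..n}.
     fps_const (Abs_fps (letter_sum ry n (descends \<pi>))) *
     Abs_fps (letter_sum (fps_const rz) n (descends (inv \<pi>))))"
  by (rule fps_ext, rule fps_ext)
    (simp add: base_series_power_nth_eq_letter_sums fps_sum_nth letter_sum_fps_const)

text \<open>Since (i j)^l = i^l j^l, the double series of each partition splits into a series in s
  and a series in t.\<close>

lemma st_coeff_eq_partition_sum:
  "st_coeff n = (\<Sum>\<mu>\<in>partitions n.
     fps_const (fps_const (rat_reciprocal (zee \<mu>) * (\<Prod>k\<in>#\<mu>. (1 - (- ry) ^ k) * (1 - (- rz) ^ k)))) *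
     (fps_const (Abs_fps (\<lambda>i. of_nat i ^ size \<mu>)) * Abs_fps (\<lambda>j. of_nat j ^ size \<mu>)))"
proof (rule fps_ext, rule fps_ext)
  fix j i
  have "fps_nth (fps_nth (fps_const (fps_const c) *
      (fps_const (Abs_fps (\<lambda>i. of_nat i ^ l)) * Abs_fps (\<lambda>j. of_nat j ^ l))) j) i =
      c * of_nat (i * j) ^ l" for c :: "rat fps fps" and l
    by (simp add: power_mult_distrib flip: fps_of_nat)
  then show "fps_nth (fps_nth (st_coeff n) j) i = fps_nth (fps_nth (\<Sum>\<mu>\<in>partitions n.
     fps_const (fps_const (rat_reciprocal (zee \<mu>) * (\<Prod>k\<in>#\<mu>. (1 - (- ry) ^ k) * (1 - (- rz) ^ k)))) *
     (fps_const (Abs_fps (\<lambda>i. of_nat i ^ size \<mu>)) * Abs_fps (\<lambda>j. of_nat j ^ size \<mu>))) j) i"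
    by (simp only: fps_sum_nth fps_nth_Abs_fps base_series_power_nth)
qed

text \<open>The term of \<open>\<pi>\<close> factors into a monomial in y, s for
  \<open>\<pi>\<close> and one in z, t for \<open>inv \<pi>\<close>;
  \<open>\<phi>_letter_sum\<close> identifies each with a letter series.\<close>

lemma pk_des_poly_eq_st_coeff:
  assumes "n \<ge> 1"
  shows "(((1 + vy * vs) * (1 + vz * vt)) / ((1 - vs) * (1 - vt))) ^ (n + 1) *
       pk_des_poly n
         ((1 + vy)\<^sup>2 * vs / ((vy + vs) * (1 + vy * vs)))
         ((1 + vz)\<^sup>2 * vt / ((vz + vt) * (1 + vz * vt)))
         ((vy + vs) / (1 + vy * vs))
         ((vz + vt) / (1 + vz * vt)) /
       ((1 + vy) * (1 + vz)) = to_fract (st_coeff n)"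
proof -
  have y: "1 + ry \<noteq> 0"
  proof -
    have "fps_nth (fps_nth (1 + ry) 0) 0 \<noteq> 0" by simp
    then show ?thesis by (metis fps_zero_nth)
  qed
  have z: "1 + fps_const rz \<noteq> 0"
  proof -
    have "fps_nth (fps_nth (1 + fps_const rz) 0) 0 \<noteq> 0" by simp
    then show ?thesis by (metis fps_zero_nth)
  qed
  define a a' where "a = (1 + vy * vs) / (1 - vs)" and "a' = (1 + vz * vt) / (1 - vt)"
  define b b' where "b = (1 + vy)\<^sup>2 * vs / ((vy + vs) * (1 + vy * vs))"
    and "b' = (1 + vz)\<^sup>2 * vt / ((vz + vt) * (1 + vz * vt))"
  define c c' where "c = (vy + vs) / (1 + vy * vs)" and "c' = (vz + vt) / (1 + vz * vt)"
  note defs = a_def a'_def b_def b'_def c_def c'_def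
  have "((1 + vy * vs) * (1 + vz * vt)) / ((1 - vs) * (1 - vt)) = a * a'"
    by (simp add: defs)
  then have "(((1 + vy * vs) * (1 + vz * vt)) / ((1 - vs) * (1 - vt))) ^ (n + 1) *
      pk_des_poly n b b' c c' / ((1 + vy) * (1 + vz)) =
    (\<Sum>\<pi> | \<pi> permutes {1..n}. (a ^ (n + 1) * b ^ (pk n \<pi> + 1) * c ^ (des n \<pi> + 1) / (1 + vy)) *
      (a' ^ (n + 1) * b' ^ (pk n (inv \<pi>) + 1) * c' ^ (des n (inv \<pi>) + 1) / (1 + vz)))"
    unfolding pk_des_poly_def sum_distrib_left sum_divide_distrib ipk_def ides_def
    by (simp add: power_mult_distrib mult_ac)
  also have "\<dots> = (\<Sum>\<pi> | \<pi> permutes {1..n}.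
      to_fract (fps_const (Abs_fps (letter_sum ry n (descends \<pi>)))) *
      to_fract (Abs_fps (letter_sum (fps_const rz) n (descends (inv \<pi>)))))"
  proof (intro sum.cong refl arg_cong2[of _ _ _ _ "(*)"])
    fix \<pi> assume "\<pi> \<in> {\<pi>. \<pi> permutes {1..n}}"
    then have p: "\<pi> permutes {1..n}" by simp
    show "a ^ (n + 1) * b ^ (pk n \<pi> + 1) * c ^ (des n \<pi> + 1) / (1 + vy) =
        to_fract (fps_const (Abs_fps (letter_sum ry n (descends \<pi>))))"
      unfolding defs vy_def vs_def by (rule inner.\<phi>_letter_sum) (use assms p y in auto)
    show "a' ^ (n + 1) * b' ^ (pk n (inv \<pi>) + 1) * c' ^ (des n (inv \<pi>) + 1) / (1 + vz) =
        to_fract (Abs_fps (letter_sum (fps_const rz) n (descends (inv \<pi>))))"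
      unfolding defs vz_def vt_def
      by (rule outer.\<phi>_letter_sum) (use assms permutes_inv[OF p] z in auto)
  qed
  also have "\<dots> = to_fract (st_coeff n)"
    by (simp only: st_coeff_eq_letter_sums outer.\<phi>_sum to_fract_mult)
  finally show ?thesis unfolding defs .
qed

lemma to_fract_st_coeff_eq_partition_sum:
  "to_fract (st_coeff n) = (\<Sum>\<mu>\<in>partitions n.
         (\<Prod>k\<in>#\<mu>. (1 - (- vy) ^ k) * (1 - (- vz) ^ k)) / of_nat (zee \<mu>) *
         (eulerian_poly (size \<mu>) vs * eulerian_poly (size \<mu>) vt /
          ((1 - vs) ^ (size \<mu> + 1) * (1 - vt) ^ (size \<mu> + 1))))"
proof -
  define \<iota> :: "rat fps fps \<Rightarrow> coeff_field" where "\<iota> c = to_fract (fps_const (fps_const c))" for c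
  have hom: "\<iota> 1 = 1" "\<iota> (c * d) = \<iota> c * \<iota> d" "\<iota> (c - d) = \<iota> c - \<iota> d" "\<iota> (- c) = - \<iota> c"
    "\<iota> (c + d) = \<iota> c + \<iota> d" "\<iota> 0 = 0" for c d
    by (simp_all add: \<iota>_def flip: fps_const_add fps_const_sub fps_const_mult fps_const_neg
        to_fract_add to_fract_diff to_fract_mult to_fract_uminus)
  have hom_power: "\<iota> (c ^ k) = \<iota> c ^ k" for c k
    by (induction k) (simp_all add: hom)
  have hom_nat: "\<iota> (of_nat k) = of_nat k" for k
    by (induction k) (simp_all add: hom)
  have hom_prod: "\<iota> (\<Prod>k\<in>#\<mu>. f k) = (\<Prod>k\<in>#\<mu>. \<iota> (f k))" for \<mu> :: "nat multiset" and f
    by (induction \<mu>) (simp_all add: hom)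
  have vyz: "\<iota> ry = vy" "\<iota> rz = vz" by (simp_all add: \<iota>_def vy_def vz_def)
  have recip: "\<iota> (rat_reciprocal k) = 1 / of_nat k" if "k > 0" for k
  proof -
    have "of_nat k * \<iota> (rat_reciprocal k) = 1"
      using arg_cong[OF rat_reciprocal[OF that], of \<iota>] by (simp add: hom hom_nat)
    then show ?thesis by (metis eq_divide_imp mult.commute mult_zero_left zero_neq_one)
  qed
  have E: "to_fract (fps_const (Abs_fps (\<lambda>i. of_nat i ^ l))) = eulerian_poly l vs / (1 - vs) ^ (l + 1)"
    "to_fract (Abs_fps (\<lambda>j. of_nat j ^ l)) = eulerian_poly l vt / (1 - vt) ^ (l + 1)" for l
    unfolding vs_def vt_def by (rule inner.\<phi>_powers_gf, rule outer.\<phi>_powers_gf)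
  have "to_fract (st_coeff n) = (\<Sum>\<mu>\<in>partitions n.
     \<iota> (rat_reciprocal (zee \<mu>) * (\<Prod>k\<in>#\<mu>. (1 - (- ry) ^ k) * (1 - (- rz) ^ k))) *
     (eulerian_poly (size \<mu>) vs / (1 - vs) ^ (size \<mu> + 1) *
      (eulerian_poly (size \<mu>) vt / (1 - vt) ^ (size \<mu> + 1))))"
    by (simp only: st_coeff_eq_partition_sum outer.\<phi>_sum to_fract_mult E \<iota>_def)
  also have "\<dots> = (\<Sum>\<mu>\<in>partitions n.
         (\<Prod>k\<in>#\<mu>. (1 - (- vy) ^ k) * (1 - (- vz) ^ k)) / of_nat (zee \<mu>) *
         (eulerian_poly (size \<mu>) vs * eulerian_poly (size \<mu>) vt /
          ((1 - vs) ^ (size \<mu> + 1) * (1 - vt) ^ (size \<mu> + 1))))"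
  proof (intro sum.cong refl)
    fix \<mu> assume "\<mu> \<in> partitions n"
    then have "zee \<mu> > 0" by (intro zee_pos) (simp add: partitions_def)
    then have "\<iota> (rat_reciprocal (zee \<mu>) * (\<Prod>k\<in>#\<mu>. (1 - (- ry) ^ k) * (1 - (- rz) ^ k))) =
        (\<Prod>k\<in>#\<mu>. (1 - (- vy) ^ k) * (1 - (- vz) ^ k)) / of_nat (zee \<mu>)"
      by (simp only: hom hom_power hom_prod vyz recip) simp
    then show "\<iota> (rat_reciprocal (zee \<mu>) * (\<Prod>k\<in>#\<mu>. (1 - (- ry) ^ k) * (1 - (- rz) ^ k))) *
     (eulerian_poly (size \<mu>) vs / (1 - vs) ^ (size \<mu> + 1) *
      (eulerian_poly (size \<mu>) vt / (1 - vt) ^ (size \<mu> + 1))) =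
     (\<Prod>k\<in>#\<mu>. (1 - (- vy) ^ k) * (1 - (- vz) ^ k)) / of_nat (zee \<mu>) *
         (eulerian_poly (size \<mu>) vs * eulerian_poly (size \<mu>) vt /
          ((1 - vs) ^ (size \<mu> + 1) * (1 - vt) ^ (size \<mu> + 1)))"
      by (simp only: times_divide_times_eq)
  qed
  finally show ?thesis .
qed

text \<open>Every power of the base series has constant term 1 in x, leaving a product of two
  geometric series.\<close>

lemma to_fract_st_coeff_0: "to_fract (st_coeff 0) = 1 / ((1 - vs) * (1 - vt))"
proof -
  have "st_coeff 0 = fps_const (Abs_fps (\<lambda>i. of_nat i ^ 0)) * Abs_fps (\<lambda>j. of_nat j ^ 0)"
    by (simp add: fps_eq_iff base_series_nth_0 fps_nth_power_0)
  then have "to_fract (st_coeff 0) = to_fract (fps_const (Abs_fps (\<lambda>i. of_nat i ^ 0))) *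
      to_fract (Abs_fps (\<lambda>j. of_nat j ^ 0))"
    by (simp only: to_fract_mult)
  then show ?thesis
    unfolding inner.\<phi>_powers_gf outer.\<phi>_powers_gf by (simp add: eulerian_poly_def vs_def vt_def)
qed

theorem theorem3p1:
  "fps_const (1 / ((1 - vs) * (1 - vt))) +
     Abs_fps (\<lambda>n. if n = 0 then 0 else
       (((1 + vy * vs) * (1 + vz * vt)) / ((1 - vs) * (1 - vt))) ^ (n + 1) *
       pk_des_poly n
         ((1 + vy)\<^sup>2 * vs / ((vy + vs) * (1 + vy * vs)))
         ((1 + vz)\<^sup>2 * vt / ((vz + vt) * (1 + vz * vt)))
         ((vy + vs) / (1 + vy * vs))
         ((vz + vt) / (1 + vz * vt)) /
       ((1 + vy) * (1 + vz)))
     = sum_st (\<lambda>i j. base_series ^ (i * j))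
   \<and>
   (\<forall>n\<ge>1.
       (((1 + vy * vs) * (1 + vz * vt)) / ((1 - vs) * (1 - vt))) ^ (n + 1) *
       pk_des_poly n
         ((1 + vy)\<^sup>2 * vs / ((vy + vs) * (1 + vy * vs)))
         ((1 + vz)\<^sup>2 * vt / ((vz + vt) * (1 + vz * vt)))
         ((vy + vs) / (1 + vy * vs))
         ((vz + vt) / (1 + vz * vt)) /
       ((1 + vy) * (1 + vz))
     = (\<Sum>\<mu>\<in>partitions n.
         (\<Prod>k\<in>#\<mu>. (1 - (- vy) ^ k) * (1 - (- vz) ^ k)) / of_nat (zee \<mu>) *
         (eulerian_poly (size \<mu>) vs * eulerian_poly (size \<mu>) vt /
          ((1 - vs) ^ (size \<mu> + 1) * (1 - vt) ^ (size \<mu> + 1)))))"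
  (is "fps_const ?c + Abs_fps (\<lambda>n. if n = 0 then 0 else ?L n) = _ \<and> (\<forall>n\<ge>1. ?L n = ?R n)")
proof (intro conjI allI impI)
  show "fps_const ?c + Abs_fps (\<lambda>n. if n = 0 then 0 else ?L n) = sum_st (\<lambda>i j. base_series ^ (i * j))"
  proof (rule fps_ext)
    fix n
    show "fps_nth (fps_const ?c + Abs_fps (\<lambda>n. if n = 0 then 0 else ?L n)) n =
        fps_nth (sum_st (\<lambda>i j. base_series ^ (i * j))) n"
    proof (cases "n = 0")
      case True
      then show ?thesis
        by (simp only: sum_st_def fps_nth_Abs_fps to_fract_st_coeff_0 fps_add_nth fps_nth_fps_const
            if_True add_0_right refl)
    next
      case False
      then have "?L n = to_fract (st_coeff n)" by (intro pk_des_poly_eq_st_coeff) simp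
      with False show ?thesis
        by (simp only: sum_st_def fps_nth_Abs_fps fps_add_nth fps_nth_fps_const if_False add_0_left)
    qed
  qed
  fix n :: nat assume "n \<ge> 1"
  then show "?L n = ?R n"
    by (simp only: pk_des_poly_eq_st_coeff to_fract_st_coeff_eq_partition_sum)
qed

end
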